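(* Suppose $X^h$ is a subspace of $V$ consisting of piecewise polynomials with respect to the triangulation $\mathcal{T}_h$, and suppose there exist no type I edges in the set $\mathcal{E}_h^I$ of interior edges. Then $X^h\subset H^2(\Omega)$.
   Context: $\Omega\subset\mathbf{R}^2$ is a bounded domain with piecewise smooth boundary, and $\mathcal{T}_h$ is a quasi-uniform triangulation of $\Omega$ with mesh size $h\in(0,1)$. $\mathcal{E}_h^I$ is the set of interior edges of $\mathcal{T}_h$, i.e. edges common to two triangles of $\mathcal{T}_h$. With $\Box v:=\partial_{xx}v-\partial_{yy}v$ (in the sense of distributions), $V:=\{v\in H^1(\Omega):\ \Box v\in L^2(\Omega)\}$. "Piecewise polynomial" means that the restriction to each $T\in\mathcal{T}_h$ is a polynomial. For an edge $e$ with unit normal $n=(n_1,n_2)$ and unit tangent $\tau$, put $\bar n:=(n_1,-n_2)$. The edge $e$ is called type I if $\bar n=\tau$ or $\bar n=-\tau$ (equivalently, $e$ makes an angle $\pm\pi/4$ with the $x$-axis); otherwise it is called type II. *)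

theory Defs
  imports "HOL-Analysis.Analysis"
begin

type_synonym plane = "real \<times> real"


section \<open>Test functions, weak derivatives and Sobolev spaces\<close>

definition partial_x :: "(plane \<Rightarrow> real) \<Rightarrow> plane \<Rightarrow> real" where
  "partial_x f p = deriv (\<lambda>t. f (t, snd p)) (fst p)"

definition partial_y :: "(plane \<Rightarrow> real) \<Rightarrow> plane \<Rightarrow> real" where
  "partial_y f p = deriv (\<lambda>t. f (fst p, t)) (snd p)"

primrec Ck_function :: "nat \<Rightarrow> (plane \<Rightarrow> real) \<Rightarrow> bool" where
  "Ck_function 0 f \<longleftrightarrow> continuous_on UNIV f"
| "Ck_function (Suc k) f \<longleftrightarrow>
     f differentiable_on UNIV \<and> Ck_function k (partial_x f) \<and> Ck_function k (partial_y f)"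

definition test_functions :: "plane set \<Rightarrow> (plane \<Rightarrow> real) set" where
  "test_functions \<Omega> =
     {\<phi>. (\<forall>k. Ck_function k \<phi>) \<and> compact (closure {p. \<phi> p \<noteq> 0}) \<and> closure {p. \<phi> p \<noteq> 0} \<subseteq> \<Omega>}"

text \<open>Elements of the function spaces are represented by functions on the whole plane whose values
  outside \<open>\<Omega>\<close> are irrelevant; all the spaces below are closed under changes on null sets.\<close>

definition L2 :: "plane set \<Rightarrow> (plane \<Rightarrow> real) set" where
  "L2 \<Omega> = {v. v \<in> borel_measurable (lebesgue_on \<Omega>) \<and> integrable (lebesgue_on \<Omega>) (\<lambda>p. (v p)\<^sup>2)}"

definition weak_partial_x :: "plane set \<Rightarrow> (plane \<Rightarrow> real) \<Rightarrow> (plane \<Rightarrow> real) \<Rightarrow> bool" where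
  "weak_partial_x \<Omega> v g \<longleftrightarrow>
     (\<forall>\<phi>\<in>test_functions \<Omega>.
        (\<integral>p. v p * partial_x \<phi> p \<partial>lebesgue_on \<Omega>) = - (\<integral>p. g p * \<phi> p \<partial>lebesgue_on \<Omega>))"

definition weak_partial_y :: "plane set \<Rightarrow> (plane \<Rightarrow> real) \<Rightarrow> (plane \<Rightarrow> real) \<Rightarrow> bool" where
  "weak_partial_y \<Omega> v g \<longleftrightarrow>
     (\<forall>\<phi>\<in>test_functions \<Omega>.
        (\<integral>p. v p * partial_y \<phi> p \<partial>lebesgue_on \<Omega>) = - (\<integral>p. g p * \<phi> p \<partial>lebesgue_on \<Omega>))"

primrec sobolev :: "nat \<Rightarrow> plane set \<Rightarrow> (plane \<Rightarrow> real) set" where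
  "sobolev 0 \<Omega> = L2 \<Omega>"
| "sobolev (Suc k) \<Omega> =
     {v \<in> L2 \<Omega>. \<exists>g1\<in>sobolev k \<Omega>. \<exists>g2\<in>sobolev k \<Omega>. weak_partial_x \<Omega> v g1 \<and> weak_partial_y \<Omega> v g2}"

abbreviation H1 :: "plane set \<Rightarrow> (plane \<Rightarrow> real) set" where
  "H1 \<equiv> sobolev 1"

abbreviation H2 :: "plane set \<Rightarrow> (plane \<Rightarrow> real) set" where
  "H2 \<equiv> sobolev 2"

definition box :: "(plane \<Rightarrow> real) \<Rightarrow> plane \<Rightarrow> real" where
  "box \<phi> p = partial_x (partial_x \<phi>) p - partial_y (partial_y \<phi>) p"

text \<open>\<open>box\<close> is formally self-adjoint, so no sign appears in its distributional version.\<close>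

definition weak_box :: "plane set \<Rightarrow> (plane \<Rightarrow> real) \<Rightarrow> (plane \<Rightarrow> real) \<Rightarrow> bool" where
  "weak_box \<Omega> v f \<longleftrightarrow>
     (\<forall>\<phi>\<in>test_functions \<Omega>.
        (\<integral>p. v p * box \<phi> p \<partial>lebesgue_on \<Omega>) = (\<integral>p. f p * \<phi> p \<partial>lebesgue_on \<Omega>))"

definition V_space :: "plane set \<Rightarrow> (plane \<Rightarrow> real) set" where
  "V_space \<Omega> = {v \<in> H1 \<Omega>. \<exists>f\<in>L2 \<Omega>. weak_box \<Omega> v f}"

definition linear_subspace_of :: "(plane \<Rightarrow> real) set \<Rightarrow> (plane \<Rightarrow> real) set \<Rightarrow> bool" where
  "linear_subspace_of X W \<longleftrightarrow>
     X \<subseteq> W \<and> (\<lambda>p. 0) \<in> X \<and> (\<forall>u\<in>X. \<forall>v\<in>X. (\<lambda>p. u p + v p) \<in> X) \<and> (\<forall>c. \<forall>v\<in>X. (\<lambda>p. c * v p) \<in> X)"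


section \<open>Domains and triangulations\<close>

definition smooth_arc :: "(real \<Rightarrow> plane) \<Rightarrow> bool" where
  "smooth_arc g \<longleftrightarrow>
     arc g \<and> g C1_differentiable_on {0..1} \<and> (\<forall>t\<in>{0..1}. vector_derivative g (at t) \<noteq> 0)"

definition piecewise_smooth_boundary :: "plane set \<Rightarrow> bool" where
  "piecewise_smooth_boundary \<Omega> \<longleftrightarrow>
     (\<exists>G. finite G \<and> (\<forall>g\<in>G. smooth_arc g) \<and> frontier \<Omega> = (\<Union>g\<in>G. path_image g))"

text \<open>Since the boundary of \<open>\<Omega>\<close> need not be polygonal, a triangle may have curved sides, but only along
  the boundary of \<open>\<Omega>\<close>. Its vertices and sides are recorded along with the point set, because a
  vertex between two curved sides need not be a geometric corner. If all three sides are segments,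
  the point set is the convex hull of the vertices.\<close>

record triangle =
  body :: "plane set"
  vertices :: "plane set"
  sides :: "plane set set"

definition side_between :: "plane set \<Rightarrow> plane \<Rightarrow> plane \<Rightarrow> plane set \<Rightarrow> bool" where
  "side_between \<Omega> a b e \<longleftrightarrow>
     e = closed_segment a b \<or>
     (\<exists>g. smooth_arc g \<and> pathstart g = a \<and> pathfinish g = b \<and> e = path_image g \<and> e \<subseteq> frontier \<Omega>)"

definition is_triangle :: "plane set \<Rightarrow> triangle \<Rightarrow> bool" where
  "is_triangle \<Omega> T \<longleftrightarrow>
     compact (body T) \<and> interior (body T) \<noteq> {} \<and>
     (\<exists>a b c \<alpha> \<beta> \<gamma>. distinct [a, b, c] \<and>
        side_between \<Omega> a b \<alpha> \<and> side_between \<Omega> b c \<beta> \<and> side_between \<Omega> c a \<gamma> \<and>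
        \<alpha> \<inter> \<beta> = {b} \<and> \<beta> \<inter> \<gamma> = {c} \<and> \<gamma> \<inter> \<alpha> = {a} \<and>
        frontier (body T) = \<alpha> \<union> \<beta> \<union> \<gamma> \<and>
        vertices T = {a, b, c} \<and> sides T = {\<alpha>, \<beta>, \<gamma>})"

text \<open>The last condition is conformity (no hanging nodes): two triangles meet in whole common sides
  and common vertices only. For straight-sided triangles this is the usual requirement that they are
  disjoint or meet in one common vertex or one common side.\<close>

definition triangulation_of :: "plane set \<Rightarrow> triangle set \<Rightarrow> bool" where
  "triangulation_of \<Omega> \<T> \<longleftrightarrow>
     finite \<T> \<and> (\<forall>T\<in>\<T>. is_triangle \<Omega> T) \<and> (\<Union>T\<in>\<T>. body T) = closure \<Omega> \<and>
     (\<forall>T\<in>\<T>. \<forall>T'\<in>\<T>. T \<noteq> T' \<longrightarrow>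
        body T \<inter> body T' = \<Union>(sides T \<inter> sides T') \<union> (vertices T \<inter> vertices T'))"

definition mesh_size :: "triangle set \<Rightarrow> real" where
  "mesh_size \<T> = Max ((\<lambda>T. diameter (body T)) ` \<T>)"

text \<open>Here \<open>\<rho>\<close> is the quasi-uniformity constant, which does not depend on the mesh size within a
  quasi-uniform family of triangulations.\<close>

definition quasi_uniform :: "real \<Rightarrow> triangle set \<Rightarrow> bool" where
  "quasi_uniform \<rho> \<T> \<longleftrightarrow> (\<forall>T\<in>\<T>. \<exists>z. cball z (\<rho> * mesh_size \<T>) \<subseteq> body T)"

definition interior_edges :: "triangle set \<Rightarrow> plane set set" where
  "interior_edges \<T> = {e. \<exists>T\<in>\<T>. \<exists>T'\<in>\<T>. T \<noteq> T' \<and> e \<in> sides T \<and> e \<in> sides T'}"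

definition unit_tangent :: "plane set \<Rightarrow> plane \<Rightarrow> bool" where
  "unit_tangent e \<tau> \<longleftrightarrow> (\<exists>a b. a \<noteq> b \<and> e = closed_segment a b \<and> \<tau> = sgn (b - a))"

definition unit_normal :: "plane set \<Rightarrow> plane \<Rightarrow> bool" where
  "unit_normal e n \<longleftrightarrow> norm n = 1 \<and> (\<exists>\<tau>. unit_tangent e \<tau> \<and> n \<bullet> \<tau> = 0)"

definition bar :: "plane \<Rightarrow> plane" where
  "bar n = (fst n, - snd n)"

text \<open>Normal and tangent of a segment are unique up to sign, so it does not matter which are chosen.\<close>

definition type_I :: "plane set \<Rightarrow> bool" where
  "type_I e \<longleftrightarrow> (\<exists>n \<tau>. unit_normal e n \<and> unit_tangent e \<tau> \<and> (bar n = \<tau> \<or> bar n = - \<tau>))"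

definition piecewise_polynomial :: "triangle set \<Rightarrow> (plane \<Rightarrow> real) \<Rightarrow> bool" where
  "piecewise_polynomial \<T> v \<longleftrightarrow>
     (\<forall>T\<in>\<T>. \<exists>q. real_polynomial_function q \<and> (AE p in lebesgue_on (body T). v p = q p))"

end

theory Submission
  imports Defs
begin

text \<open>
  A line that is not of type I is noncharacteristic for \<open>box\<close>: both a jump of \<open>v\<close> and a jump of its normal
  derivative across it would produce a singular part of \<open>box v\<close>. To see this from the weak formulation alone,
  test with products \<open>F(x + y) G(x - y)\<close>, for which \<open>box (F G) = 4 F' G'\<close>. Taking for \<open>F'\<close> and \<open>G'\<close>
  differences of two bumps turns the left-hand side into an alternating sum of averages of \<open>v\<close> at the four
  corners of a characteristic rectangle of size \<open>\<epsilon>\<close>. If only one corner lies on the first side of the line,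
  the sum is the difference of the two polynomials at that corner up to \<open>O(\<epsilon>\<^sup>2)\<close>, while the right-hand side
  is \<open>o(\<epsilon>)\<close> because \<open>box v\<close> is square integrable. Hence values and gradients agree on interior edges.

  Consequently \<open>v\<close> and its piecewise gradient are continuous on \<open>\<Omega>\<close> minus the finitely many nodes. On every
  horizontal or vertical line that misses the nodes, the product of such a function with a test function is
  continuous and differentiable outside a finite set, so by the fundamental theorem of calculus and Fubini
  the piecewise derivatives are weak derivatives. Neither the geometry at the nodes nor the curved sides
  enter, since the latter lie outside \<open>\<Omega>\<close>.
\<close>

section \<open>Smooth bump functions\<close>

text \<open>The orders in \<epsilon> decide the matter. A jump of the value enters the corner sum
  with order 1, a jump of the gradient with order \<epsilon>, so a bound O(\<epsilon>) for the
  pairing with box v would settle the values only. The sharper o(\<epsilon>) is available because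
  the mass of the square of box v on a shrinking disc tends to 0. Differences of two bumps are
  forced by compact support: an antiderivative of F' or G' vanishes far out on both sides only if
  the mean is zero. A rectangle with exactly one corner on a given side of a line exists only if the
  line is parallel to neither characteristic direction, since otherwise the corners are separated in
  pairs; this is where type I edges must be excluded. One rectangle yields one linear equation for
  the jump of the gradient, and a second one of other proportions completes the system.\<close>

primrec differentiable_times :: "nat \<Rightarrow> (real \<Rightarrow> real) \<Rightarrow> bool" where
  "differentiable_times 0 f \<longleftrightarrow> continuous_on UNIV f"
| "differentiable_times (Suc k) f \<longleftrightarrow>
     (\<exists>f'. (\<forall>x. (f has_real_derivative f' x) (at x)) \<and> differentiable_times k f')"

definition smooth :: "(real \<Rightarrow> real) \<Rightarrow> bool" where
  "smooth f \<longleftrightarrow> (\<forall>k. differentiable_times k f)"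

lemma differentiable_times_Suc_imp: "differentiable_times (Suc k) f \<Longrightarrow> differentiable_times k f"
proof (induction k arbitrary: f)
  case 0
  then show ?case
    by (auto intro!: continuous_at_imp_continuous_on intro: DERIV_isCont)
next
  case (Suc k)
  then obtain f' where "\<forall>x. (f has_real_derivative f' x) (at x)" "differentiable_times (Suc k) f'"
    by (subst (asm) (2) differentiable_times.simps) blast
  with Suc.IH show ?case
    by auto
qed

lemma smooth_continuous: "smooth f \<Longrightarrow> continuous_on S f"
  unfolding smooth_def using differentiable_times.simps(1) continuous_on_subset by blast

lemma smoothI:
  assumes "\<And>x. (f has_real_derivative f' x) (at x)" "smooth f'"
  shows "smooth f"
  unfolding smooth_def
proof
  fix k
  have "differentiable_times (Suc k) f"
    using assms by (auto simp: smooth_def)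
  then show "differentiable_times k f"
    by (rule differentiable_times_Suc_imp)
qed

text \<open>For each order the definition may supply a derivative of its own; uniqueness of
  derivatives makes all of them the same function, so one \<open>f'\<close> serves every
  order.\<close>

lemma smooth_imp_derivative:
  assumes "smooth f"
  obtains f' where "\<And>x. (f has_real_derivative f' x) (at x)" "smooth f'"
proof -
  obtain f' where f': "\<forall>x. (f has_real_derivative f' x) (at x)"
    using assms differentiable_times.simps(2) unfolding smooth_def by blast
  have "differentiable_times k f'" for k
  proof -
    obtain g where g: "\<forall>x. (f has_real_derivative g x) (at x)" "differentiable_times k g"
      using assms differentiable_times.simps(2)[of k f] unfolding smooth_def by blast
    have "g = f'"
      using f' g(1) DERIV_unique by blast
    with g(2) show ?thesis by simp
  qed
  then show ?thesis
    using that f' unfolding smooth_def by blast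
qed

lemma differentiable_times_add:
  "differentiable_times k f \<Longrightarrow> differentiable_times k g \<Longrightarrow> differentiable_times k (\<lambda>x. f x + g x)"
proof (induction k arbitrary: f g)
  case (Suc k)
  then obtain f' g' where "\<forall>x. (f has_real_derivative f' x) (at x)" "differentiable_times k f'"
      "\<forall>x. (g has_real_derivative g' x) (at x)" "differentiable_times k g'"
    by auto
  then show ?case
    using Suc.IH by (auto intro!: exI[of _ "\<lambda>x. f' x + g' x"] derivative_eq_intros)
qed (auto intro!: continuous_intros)

lemma differentiable_times_mult:
  "differentiable_times k f \<Longrightarrow> differentiable_times k g \<Longrightarrow> differentiable_times k (\<lambda>x. f x * g x)"
proof (induction k arbitrary: f g)
  case (Suc k)
  then obtain f' g' where d: "\<forall>x. (f has_real_derivative f' x) (at x)" "differentiable_times k f'"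
      "\<forall>x. (g has_real_derivative g' x) (at x)" "differentiable_times k g'"
    by auto
  have "differentiable_times k (\<lambda>x. f' x * g x + g' x * f x)"
    using Suc d differentiable_times_Suc_imp by (intro differentiable_times_add Suc.IH) auto
  moreover have "\<forall>x. ((\<lambda>x. f x * g x) has_real_derivative f' x * g x + g' x * f x) (at x)"
    using d by (auto intro!: DERIV_mult)
  ultimately show ?case
    by (auto intro!: exI[of _ "\<lambda>x. f' x * g x + g' x * f x"])
qed (auto intro!: continuous_intros)

lemma differentiable_times_const: "differentiable_times k (\<lambda>x. c)"
proof (induction k arbitrary: c)
  case (Suc k)
  then show ?case
    by (auto intro!: exI[of _ "\<lambda>x. 0"])
qed auto

lemma smooth_const [simp]: "smooth (\<lambda>x. c)"
  by (simp add: smooth_def differentiable_times_const)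

lemma smooth_add: "smooth f \<Longrightarrow> smooth g \<Longrightarrow> smooth (\<lambda>x. f x + g x)"
  by (simp add: smooth_def differentiable_times_add)

lemma smooth_mult: "smooth f \<Longrightarrow> smooth g \<Longrightarrow> smooth (\<lambda>x. f x * g x)"
  by (simp add: smooth_def differentiable_times_mult)

lemma smooth_diff: "smooth f \<Longrightarrow> smooth g \<Longrightarrow> smooth (\<lambda>x. f x - g x)"
  using smooth_add[of f "\<lambda>x. (- 1) * g x"] smooth_mult[of "\<lambda>x. - 1" g] by simp

lemma smooth_affine:
  assumes "smooth f" shows "smooth (\<lambda>x. f (a * x + b))"
proof -
  \<comment> \<open>The induction assumes full smoothness of \<open>f\<close>, so that
    \<open>f'\<close> satisfies the same hypothesis at the lower order.\<close>
  have "differentiable_times k (\<lambda>x. f (a * x + b))" if "smooth f" for k f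
    using that
  proof (induction k arbitrary: f)
    case 0
    then have "continuous_on UNIV f"
      by (rule smooth_continuous)
    then show ?case
      using continuous_on_compose2[of UNIV f UNIV "\<lambda>x. a * x + b"] by (simp add: continuous_intros)
  next
    case (Suc k)
    from \<open>smooth f\<close> obtain f' where f': "\<And>x. (f has_real_derivative f' x) (at x)" "smooth f'"
      using smooth_imp_derivative by blast
    have "((\<lambda>x. f (a * x + b)) has_real_derivative a * f' (a * x + b)) (at x)" for x
    proof -
      have "((\<lambda>x. a * x + b) has_real_derivative a) (at x)"
        by (auto intro!: derivative_eq_intros)
      then show ?thesis
        using DERIV_chain2[OF f'(1), of "\<lambda>x. a * x + b" a x] by (simp add: mult.commute)
    qed
    moreover have "differentiable_times k (\<lambda>x. a * f' (a * x + b))"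
      by (intro differentiable_times_mult differentiable_times_const Suc.IH f')
    ultimately show ?case
      by (simp only: differentiable_times.simps) (intro exI conjI allI)
  qed
  with assms show ?thesis
    by (simp add: smooth_def)
qed

section \<open>The flat function exp(-1/t) and the bump built from it\<close>

definition flat_exp :: "real poly \<Rightarrow> real \<Rightarrow> real" where
  "flat_exp P t = (if t > 0 then poly P (1 / t) * exp (- (1 / t)) else 0)"

lemma poly_exp_decay: "((\<lambda>u. poly P u * exp (- u)) \<longlongrightarrow> 0) at_top" for P :: "real poly"
proof -
  have "((\<lambda>u. \<Sum>i\<le>degree P. coeff P i * (u ^ i / exp u)) \<longlongrightarrow> (\<Sum>i\<le>degree P. coeff P i * 0)) at_top"
    by (intro tendsto_intros tendsto_power_div_exp_0)
  then show ?thesis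
    by (simp add: poly_altdef sum_distrib_right exp_minus divide_inverse mult.assoc)
qed

text \<open>The polynomial factor makes the family closed under differentiation: with u = 1/t one
  has du/dt = -u^2, so P(u) exp(-u) has the derivative u^2 (P - P')(u) exp(-u), and
  \<open>[:0, 0, 1:]\<close> is u^2.\<close>

lemma flat_exp_has_derivative:
  "(flat_exp P has_real_derivative flat_exp ([:0, 0, 1:] * (P - pderiv P)) t) (at t)"
proof -
  consider "t > 0" | "t < 0" | "t = 0" by linarith
  then show ?thesis
  proof cases
    case 1
    have "((\<lambda>t. poly P (1 / t) * exp (- (1 / t))) has_real_derivative
        flat_exp ([:0, 0, 1:] * (P - pderiv P)) t) (at t)"
    proof -
      have d: "((\<lambda>t. 1 / t) has_real_derivative - (1 / t\<^sup>2)) (at t)"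
        using 1 by (auto intro!: derivative_eq_intros simp: power2_eq_square)
      show ?thesis
        using 1 by (intro DERIV_cong[OF DERIV_mult[OF DERIV_chain2[OF poly_DERIV d, of P]
              DERIV_chain2[OF DERIV_exp DERIV_minus[OF d]]]])
          (simp add: flat_exp_def power2_eq_square field_simps)
    qed
    moreover have "\<forall>\<^sub>F s in nhds t. s > 0"
      using 1 eventually_nhds_in_open[of "{0<..}" t] by simp
    then have "\<forall>\<^sub>F s in nhds t. poly P (1 / s) * exp (- (1 / s)) = flat_exp P s"
      by eventually_elim (simp add: flat_exp_def)
    ultimately show ?thesis
      using DERIV_cong_ev[OF refl _ refl] by fast
  next
    case 2
    have "\<forall>\<^sub>F s in nhds t. s < 0"
      using 2 eventually_nhds_in_open[of "{..<0}" t] by simp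
    then have "\<forall>\<^sub>F s in nhds t. 0 = flat_exp P s"
      by eventually_elim (simp add: flat_exp_def)
    moreover have "((\<lambda>t. 0) has_real_derivative flat_exp ([:0, 0, 1:] * (P - pderiv P)) t) (at t)"
      using 2 by (simp add: flat_exp_def)
    ultimately show ?thesis
      using DERIV_cong_ev[OF refl _ refl] by fast
  next
    case 3
    have "((\<lambda>h. flat_exp P h / h) \<longlongrightarrow> 0) (at_left 0)"
      by (rule tendsto_eventually) (auto simp: flat_exp_def eventually_at_left_field intro!: exI[of _ "-1"])
    moreover have "((\<lambda>h. flat_exp P h / h) \<longlongrightarrow> 0) (at_right 0)"
    proof -
      \<comment> \<open>Dividing by \<open>h\<close> multiplies by u = 1/h, hence the extra factor
        \<open>[:0, 1:]\<close>.\<close>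
      have "((\<lambda>h. poly ([:0, 1:] * P) (inverse h) * exp (- inverse h)) \<longlongrightarrow> 0) (at_right 0)"
        using filterlim_compose[OF poly_exp_decay[of "[:0, 1:] * P"] filterlim_inverse_at_top_right] .
      moreover have "\<forall>\<^sub>F h in at_right 0. h > (0::real)"
        by (simp add: eventually_at_right_less)
      then have "\<forall>\<^sub>F h in at_right 0. poly ([:0, 1:] * P) (inverse h) * exp (- inverse h) = flat_exp P h / h"
        by eventually_elim (simp add: flat_exp_def field_simps)
      ultimately show ?thesis
        using tendsto_cong by force
    qed
    ultimately have "((\<lambda>h. flat_exp P h / h) \<longlongrightarrow> 0) (at 0)"
      by (simp add: filterlim_split_at)
    with 3 show ?thesis
      by (simp add: DERIV_def flat_exp_def)
  qed
qed

lemma smooth_flat_exp: "smooth (flat_exp P)"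
proof -
  have "differentiable_times k (flat_exp P)" for k
  proof (induction k arbitrary: P)
    case 0
    show ?case
      using flat_exp_has_derivative by (auto intro!: continuous_at_imp_continuous_on DERIV_isCont)
  next
    case (Suc k)
    then show ?case
      using flat_exp_has_derivative by (subst differentiable_times.simps) blast
  qed
  then show ?thesis
    by (simp add: smooth_def)
qed

text \<open>Positive exactly on the open interval from -1 to 1, and even, so that its centre of mass
  is 0.\<close>

definition bump :: "real \<Rightarrow> real" where
  "bump t = flat_exp 1 (1 + t) * flat_exp 1 (1 - t)"

lemma smooth_bump: "smooth bump"
  unfolding bump_def[abs_def]
  using smooth_mult[OF smooth_affine[OF smooth_flat_exp, of 1 1 1] smooth_affine[OF smooth_flat_exp, of 1 "-1" 1]]
  by (simp add: add.commute)

lemma bump_nonneg: "bump t \<ge> 0"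
  by (simp add: bump_def flat_exp_def)

lemma bump_even: "bump (- t) = bump t"
  by (simp add: bump_def mult.commute)

lemma bump_eq_0: "\<bar>t\<bar> \<ge> 1 \<Longrightarrow> bump t = 0"
  by (auto simp: bump_def flat_exp_def)

lemma bump_0_pos: "bump 0 > 0"
  by (simp add: bump_def flat_exp_def)

lemma integrable_continuous_compact_support:
  fixes f :: "'a::euclidean_space \<Rightarrow> real"
  assumes "continuous_on UNIV f" "\<And>x. norm x > R \<Longrightarrow> f x = 0"
  shows "integrable lborel f"
proof -
  have "integrable lborel (\<lambda>x. indicator (cball 0 R) x *\<^sub>R f x)"
    using assms(1) by (intro borel_integrable_compact) (auto intro: continuous_on_subset)
  moreover have "(\<lambda>x. indicator (cball 0 R) x *\<^sub>R f x) = f"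
    using assms(2) by (auto simp: indicator_def fun_eq_iff not_le)
  ultimately show ?thesis
    by simp
qed

lemma integrable_continuous_bump:
  assumes "continuous_on UNIV f"
  shows "integrable lborel (\<lambda>x. f x * bump (x - s))"
proof (rule integrable_continuous_compact_support)
  show "continuous_on UNIV (\<lambda>x. f x * bump (x - s))"
    by (intro continuous_intros assms continuous_on_compose2[OF smooth_continuous[OF smooth_bump]]) auto
  show "f x * bump (x - s) = 0" if "norm x > \<bar>s\<bar> + 1" for x
    using that by (auto intro!: bump_eq_0)
qed

text \<open>The bump is not normalised; its mass is carried along as the common factor
  \<open>bump_mass\<^sup>2\<close> and divided out in the jump relation.\<close>

definition bump_mass :: real where
  "bump_mass = (\<integral>x. bump x \<partial>lborel)"

lemma integrable_bump: "integrable lborel bump"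
  using integrable_continuous_bump[of "\<lambda>_. 1" 0] by simp

text \<open>A nonnegative function with integral zero vanishes almost everywhere, but
  \<open>bump\<close> is nonzero on an open set around 0, which is not negligible.\<close>

lemma bump_mass_pos: "bump_mass > 0"
proof -
  have cont: "continuous_on UNIV bump"
    by (rule smooth_continuous[OF smooth_bump])
  have "bump_mass \<ge> 0"
    unfolding bump_mass_def by (intro integral_nonneg_AE) (simp add: bump_nonneg)
  moreover have "bump_mass \<noteq> 0"
  proof
    assume "bump_mass = 0"
    then have "AE x in lborel. bump x = 0"
      unfolding bump_mass_def
      by (subst (asm) integral_nonneg_eq_0_iff_AE) (auto simp: bump_nonneg integrable_bump)
    then have "negligible {x. bump x \<noteq> 0}"
      using AE_iff_null_sets[of "{x. bump x \<noteq> 0}" lborel] open_Collect_neq[OF cont continuous_on_const, of 0]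
      by (auto simp: negligible_iff_null_sets intro!: null_sets_completionI)
    moreover have "open {x. bump x \<noteq> 0}"
      using open_Collect_neq[OF cont continuous_on_const] .
    moreover have "0 \<in> {x. bump x \<noteq> 0}"
      using bump_0_pos by auto
    ultimately show False
      using open_not_negligible by blast
  qed
  ultimately show ?thesis by simp
qed

section \<open>Test functions adapted to the wave operator\<close>

text \<open>The partial derivatives are defined by \<open>deriv\<close>; once a total derivative is
  known, uniqueness of derivatives along the two axes computes them.\<close>

lemma has_derivative_imp_partials:
  assumes "(f has_derivative D) (at p)"
  shows "((\<lambda>t. f (t, snd p)) has_real_derivative D (1, 0)) (at (fst p))"
    and "((\<lambda>t. f (fst p, t)) has_real_derivative D (0, 1)) (at (snd p))"
    and "partial_x f p = D (1, 0)" and "partial_y f p = D (0, 1)"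
proof -
  interpret D: bounded_linear D
    using assms by (rule has_derivative_bounded_linear)
  have "((\<lambda>t. f (t, snd p)) has_derivative (\<lambda>h. D (h, 0))) (at (fst p))"
    by (rule has_derivative_compose[where g = f and f = "\<lambda>t. (t, snd p)"])
      (use assms in \<open>auto intro!: derivative_eq_intros\<close>)
  moreover have "(\<lambda>h. D (h, 0)) = (*) (D (1, 0))"
  proof
    show "D (h, 0) = D (1, 0) * h" for h
      by (rule trans[OF _ trans[OF D.scaleR[of h "(1, 0)"]]]) simp_all
  qed
  ultimately show x: "((\<lambda>t. f (t, snd p)) has_real_derivative D (1, 0)) (at (fst p))"
    by (simp only: has_field_derivative_def)
  have "((\<lambda>t. f (fst p, t)) has_derivative (\<lambda>h. D (0, h))) (at (snd p))"
    by (rule has_derivative_compose[where g = f and f = "\<lambda>t. (fst p, t)"])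
      (use assms in \<open>auto intro!: derivative_eq_intros\<close>)
  moreover have "(\<lambda>h. D (0, h)) = (*) (D (0, 1))"
  proof
    show "D (0, h) = D (0, 1) * h" for h
      by (rule trans[OF _ trans[OF D.scaleR[of h "(0, 1)"]]]) simp_all
  qed
  ultimately show y: "((\<lambda>t. f (fst p, t)) has_real_derivative D (0, 1)) (at (snd p))"
    by (simp only: has_field_derivative_def)
  show "partial_x f p = D (1, 0)" "partial_y f p = D (0, 1)"
    using x y by (simp_all add: partial_x_def partial_y_def DERIV_imp_deriv)
qed

text \<open>Each partial derivative of a product in characteristic coordinates is a combination of
  two such products, so the induction on the order needs this closure property.\<close>

lemma Ck_function_add_scale:
  "Ck_function k f \<Longrightarrow> Ck_function k g \<Longrightarrow> Ck_function k (\<lambda>p. a * f p + b * g p)"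
proof (induction k arbitrary: f g)
  case 0
  then show ?case
    by (auto intro!: continuous_intros)
next
  case (Suc k)
  have d: "\<exists>D E. (f has_derivative D) (at p) \<and> (g has_derivative E) (at p)" for p
    using Suc.prems unfolding Ck_function.simps differentiable_on_def differentiable_def by blast
  have "partial_x (\<lambda>p. a * f p + b * g p) p = a * partial_x f p + b * partial_x g p \<and>
      partial_y (\<lambda>p. a * f p + b * g p) p = a * partial_y f p + b * partial_y g p" for p
  proof -
    obtain D E where DE: "(f has_derivative D) (at p)" "(g has_derivative E) (at p)"
      using d by blast
    then have "((\<lambda>p. a * f p + b * g p) has_derivative (\<lambda>h. a * D h + b * E h)) (at p)"
      by (intro derivative_intros)
    then show ?thesis
      using DE by (simp add: has_derivative_imp_partials)
  qed
  then have "partial_x (\<lambda>p. a * f p + b * g p) = (\<lambda>p. a * partial_x f p + b * partial_x g p)"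
      "partial_y (\<lambda>p. a * f p + b * g p) = (\<lambda>p. a * partial_y f p + b * partial_y g p)"
    by auto
  moreover have "(\<lambda>p. a * f p + b * g p) differentiable_on UNIV"
    using Suc.prems by (auto intro!: derivative_intros)
  ultimately show ?case
    using Suc by simp
qed

text \<open>The wave operator factors in the characteristic coordinates \<open>x + y\<close> and \<open>x - y\<close>.\<close>

definition char_tensor :: "plane \<Rightarrow> real \<Rightarrow> (real \<Rightarrow> real) \<Rightarrow> (real \<Rightarrow> real) \<Rightarrow> plane \<Rightarrow> real" where
  "char_tensor c \<epsilon> F G p =
     F ((fst p - fst c + (snd p - snd c)) / \<epsilon>) * G ((fst p - fst c - (snd p - snd c)) / \<epsilon>)"

lemma char_tensor_has_derivative:
  assumes F: "\<And>x. (F has_real_derivative F' x) (at x)" and G: "\<And>x. (G has_real_derivative G' x) (at x)"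
  shows "(char_tensor c \<epsilon> F G has_derivative
    (\<lambda>h. (fst h + snd h) / \<epsilon> * char_tensor c \<epsilon> F' G p + (fst h - snd h) / \<epsilon> * char_tensor c \<epsilon> F G' p)) (at p)"
proof -
  have 1: "((\<lambda>p. F ((fst p - fst c + (snd p - snd c)) / \<epsilon>)) has_derivative
      (\<lambda>h. F' ((fst p - fst c + (snd p - snd c)) / \<epsilon>) * ((fst h + snd h) / \<epsilon>))) (at p)"
    by (rule has_derivative_compose[OF _ F[unfolded has_field_derivative_def]])
       (unfold divide_inverse, auto intro!: derivative_eq_intros)
  have 2: "((\<lambda>p. G ((fst p - fst c - (snd p - snd c)) / \<epsilon>)) has_derivative
      (\<lambda>h. G' ((fst p - fst c - (snd p - snd c)) / \<epsilon>) * ((fst h - snd h) / \<epsilon>))) (at p)"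
    by (rule has_derivative_compose[OF _ G[unfolded has_field_derivative_def]])
       (unfold divide_inverse, auto intro!: derivative_eq_intros)
  show ?thesis
    using has_derivative_mult[OF 1 2] unfolding char_tensor_def[abs_def]
    by (rule has_derivative_eq_rhs) (simp add: fun_eq_iff mult_ac)
qed

lemma char_tensor_partials:
  assumes F: "\<And>x. (F has_real_derivative F' x) (at x)" and G: "\<And>x. (G has_real_derivative G' x) (at x)"
  shows "partial_x (char_tensor c \<epsilon> F G) =
      (\<lambda>p. 1 / \<epsilon> * char_tensor c \<epsilon> F' G p + 1 / \<epsilon> * char_tensor c \<epsilon> F G' p)"
    and "partial_y (char_tensor c \<epsilon> F G) =
      (\<lambda>p. 1 / \<epsilon> * char_tensor c \<epsilon> F' G p + (- 1 / \<epsilon>) * char_tensor c \<epsilon> F G' p)"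
  by (intro ext; simp only: has_derivative_imp_partials(3,4)[OF char_tensor_has_derivative[OF F G]]; simp)+

lemma Ck_function_char_tensor:
  "smooth F \<Longrightarrow> smooth G \<Longrightarrow> Ck_function k (char_tensor c \<epsilon> F G)"
proof (induction k arbitrary: F G)
  case 0
  obtain F' G' where "\<And>x. (F has_real_derivative F' x) (at x)" "\<And>x. (G has_real_derivative G' x) (at x)"
    using 0 smooth_imp_derivative by metis
  then show ?case
    by (auto intro!: continuous_at_imp_continuous_on has_derivative_continuous[OF char_tensor_has_derivative])
next
  case (Suc k)
  obtain F' G' where d: "\<And>x. (F has_real_derivative F' x) (at x)" "\<And>x. (G has_real_derivative G' x) (at x)"
    and s: "smooth F'" "smooth G'"
    using Suc.prems smooth_imp_derivative by metis
  have "char_tensor c \<epsilon> F G differentiable_on UNIV"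
    using char_tensor_has_derivative[OF d] unfolding differentiable_on_def differentiable_def by blast
  then show ?case
    using Suc s by (simp only: Ck_function.simps char_tensor_partials[OF d] Ck_function_add_scale)
qed

text \<open>The derivatives in x and y are the sum and the difference of the two characteristic
  derivatives, divided by \<epsilon>. In the difference of their squares the pure second derivatives
  cancel and four times the mixed one remains.\<close>

lemma box_char_tensor:
  assumes "smooth F" "smooth G"
    and F: "\<And>x. (F has_real_derivative F' x) (at x)" and G: "\<And>x. (G has_real_derivative G' x) (at x)"
  shows "box (char_tensor c \<epsilon> F G) p = 4 / \<epsilon>\<^sup>2 * char_tensor c \<epsilon> F' G' p"
proof -
  have "smooth F'" "smooth G'"
    using assms smooth_imp_derivative DERIV_unique by (metis ext)+
  then obtain F'' G'' where F': "\<And>x. (F' has_real_derivative F'' x) (at x)"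
    and G': "\<And>x. (G' has_real_derivative G'' x) (at x)"
    using smooth_imp_derivative by metis
  note d = char_tensor_has_derivative[OF F' G, of c \<epsilon> p] char_tensor_has_derivative[OF F G', of c \<epsilon> p]
  \<comment> \<open>\<open>s = 1\<close> is the first partial derivative in x and
    \<open>s = - 1\<close> the one in y, so both are differentiated at once.\<close>
  have "((\<lambda>p. 1 / \<epsilon> * char_tensor c \<epsilon> F' G p + s / \<epsilon> * char_tensor c \<epsilon> F G' p) has_derivative
      (\<lambda>h. 1 / \<epsilon> * ((fst h + snd h) / \<epsilon> * char_tensor c \<epsilon> F'' G p + (fst h - snd h) / \<epsilon> * char_tensor c \<epsilon> F' G' p)
         + s / \<epsilon> * ((fst h + snd h) / \<epsilon> * char_tensor c \<epsilon> F' G' p + (fst h - snd h) / \<epsilon> * char_tensor c \<epsilon> F G'' p)))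
      (at p)" for s
    by (intro derivative_intros d)
  note e = has_derivative_imp_partials(3,4)[OF this]
  show ?thesis
    unfolding box_def char_tensor_partials[OF F G] e
    by (simp add: power2_eq_square divide_inverse algebra_simps)
qed

lemma char_tensor_support:
  assumes "\<And>t. \<bar>t\<bar> > R \<Longrightarrow> F t = 0" "\<And>t. \<bar>t\<bar> > R \<Longrightarrow> G t = 0" "0 < \<epsilon>" "p \<notin> cball c (2 * R * \<epsilon>)"
  shows "char_tensor c \<epsilon> F G p = 0"
proof (rule ccontr)
  define a b where "a = fst p - fst c" and "b = snd p - snd c"
  assume "char_tensor c \<epsilon> F G p \<noteq> 0"
  then have "\<not> \<bar>(a + b) / \<epsilon>\<bar> > R" "\<not> \<bar>(a - b) / \<epsilon>\<bar> > R"
    using assms(1,2) by (auto simp: char_tensor_def a_def b_def)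
  then have "\<bar>a + b\<bar> \<le> R * \<epsilon>" "\<bar>a - b\<bar> \<le> R * \<epsilon>"
    using \<open>0 < \<epsilon>\<close> by (auto simp: abs_divide not_less divide_simps)
  then have "\<bar>a\<bar> + \<bar>b\<bar> \<le> 2 * R * \<epsilon>"
    by linarith
  moreover have "dist c p \<le> \<bar>a\<bar> + \<bar>b\<bar>"
    using norm_Pair_le[of "fst c - fst p" "snd c - snd p"]
    by (simp add: dist_norm a_def b_def minus_prod_def abs_minus_commute)
  ultimately show False
    using assms(4) by simp
qed

lemma char_tensor_test_function:
  assumes "smooth F" "smooth G" "\<And>t. \<bar>t\<bar> > R \<Longrightarrow> F t = 0" "\<And>t. \<bar>t\<bar> > R \<Longrightarrow> G t = 0" "0 < \<epsilon>"
    and "cball c (2 * R * \<epsilon>) \<subseteq> \<Omega>"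
  shows "char_tensor c \<epsilon> F G \<in> test_functions \<Omega>"
proof -
  have "closure {p. char_tensor c \<epsilon> F G p \<noteq> 0} \<subseteq> cball c (2 * R * \<epsilon>)"
    using char_tensor_support[of R F G \<epsilon> _ c] assms(3-5) by (intro closure_minimal subsetI) (auto simp del: mem_cball)
  then show ?thesis
    using assms Ck_function_char_tensor bounded_subset[OF bounded_cball] compact_closure
      closure_subset[of "{p. char_tensor c \<epsilon> F G p \<noteq> 0}"]
    unfolding test_functions_def by blast
qed

section \<open>Antiderivatives of bumps\<close>

definition bump_primitive :: "real \<Rightarrow> real" where
  "bump_primitive = (SOME B. \<forall>x. (B has_real_derivative bump x) (at x))"

lemma bump_primitive_has_derivative: "(bump_primitive has_real_derivative bump x) (at x)"
proof -
  have "\<exists>B. \<forall>x::real. - \<infinity> < ereal x \<longrightarrow> ereal x < \<infinity> \<longrightarrow> (B has_vector_derivative bump x) (at x)"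
    using smooth_continuous[OF smooth_bump, of UNIV]
    by (intro einterval_antiderivative) (auto simp: continuous_on_eq_continuous_at)
  then have "\<exists>B. \<forall>x. (B has_real_derivative bump x) (at x)"
    by (simp add: has_real_derivative_iff_has_vector_derivative)
  then show ?thesis
    unfolding bump_primitive_def by (rule someI2_ex) blast
qed

lemma bump_primitive_constant:
  assumes "a \<ge> 1 \<and> b \<ge> 1 \<or> a \<le> - 1 \<and> b \<le> - 1"
  shows "bump_primitive a = bump_primitive b"
proof -
  have "bump_primitive a = bump_primitive b" if "convex S" "\<And>x. x \<in> S \<Longrightarrow> \<bar>x\<bar> \<ge> 1" "a \<in> S" "b \<in> S" for S
  proof -
    have "\<exists>c. \<forall>x\<in>S. bump_primitive x = c"
    proof (rule has_field_derivative_zero_constant[OF that(1)])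
      fix x assume "x \<in> S"
      with that(2) have "bump x = 0"
        by (simp add: bump_eq_0)
      then show "(bump_primitive has_field_derivative 0) (at x within S)"
        using bump_primitive_has_derivative[of x] by (auto intro: has_field_derivative_at_within)
    qed
    with that(3,4) show ?thesis by auto
  qed
  from this[of "{1..}"] this[of "{..-1}"] assms show ?thesis
    by auto
qed

text \<open>The two bumps have equal mass, so this antiderivative of their difference vanishes far
  out on both sides; the additive constant left open in \<open>bump_primitive\<close>
  cancels.\<close>

definition bump_step :: "real \<Rightarrow> real \<Rightarrow> real \<Rightarrow> real" where
  "bump_step s t x = bump_primitive (x - s) - bump_primitive (x - t)"

lemma bump_step_has_derivative:
  "(bump_step s t has_real_derivative bump (x - s) - bump (x - t)) (at x)"
proof -
  have "((\<lambda>x. bump_primitive (x - r)) has_real_derivative bump (x - r)) (at x)" for r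
    using DERIV_chain2[OF bump_primitive_has_derivative DERIV_diff[OF DERIV_ident DERIV_const], of r x] by simp
  then show ?thesis
    unfolding bump_step_def[abs_def] by (intro derivative_intros)
qed

lemma smooth_bump_shift: "smooth (\<lambda>x. bump (x - s))"
  using smooth_affine[OF smooth_bump, of 1 "- s"] by simp

lemma smooth_bump_step: "smooth (bump_step s t)"
  by (rule smoothI[OF bump_step_has_derivative]) (intro smooth_diff smooth_bump_shift)

lemma bump_step_eq_0: "\<bar>x\<bar> > 1 + \<bar>s\<bar> + \<bar>t\<bar> \<Longrightarrow> bump_step s t x = 0"
  unfolding bump_step_def
  using bump_primitive_constant[of "x - s" "x - t"] by linarith

section \<open>Averages against bumps in characteristic coordinates\<close>

text \<open>The inverse of the coordinates used by \<open>char_tensor\<close>: in the variable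
  \<open>z\<close> the product becomes \<open>F (fst z) * G (snd z)\<close> for every nonzero
  \<epsilon>.\<close>

definition char_point :: "plane \<Rightarrow> real \<Rightarrow> plane \<Rightarrow> plane" where
  "char_point c \<epsilon> z = c + \<epsilon> *\<^sub>R ((fst z + snd z) / 2, (fst z - snd z) / 2)"

lemma char_point_measurable [measurable]: "char_point c \<epsilon> \<in> borel_measurable borel"
  unfolding char_point_def[abs_def]
  by (intro borel_measurable_continuous_onI continuous_intros) auto

text \<open>The Jacobian arises from two substitutions on the line: \<open>snd p\<close> at fixed
  \<open>fst p\<close> gives \<epsilon>, and after exchanging the integrals \<open>fst p\<close> at
  fixed first characteristic coordinate gives \<epsilon>/2.\<close>

lemma nn_integral_char_point:
  fixes h :: "plane \<Rightarrow> ennreal"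
  assumes [measurable]: "h \<in> borel_measurable borel" and "0 < \<epsilon>"
  shows "(\<integral>\<^sup>+p. h p \<partial>lborel) = ennreal (\<epsilon>\<^sup>2 / 2) * (\<integral>\<^sup>+z. h (char_point c \<epsilon> z) \<partial>lborel)"
proof -
  define g where "g = (\<lambda>\<xi> u. h (u, fst c + snd c + \<epsilon> * \<xi> - u))"
  have [measurable]: "h \<in> borel_measurable (borel \<Otimes>\<^sub>M borel)"
    by (simp add: borel_prod)
  have cp [measurable]: "(\<lambda>z. h (char_point c \<epsilon> z)) \<in> borel_measurable (lborel \<Otimes>\<^sub>M lborel)"
    using measurable_compose[OF char_point_measurable assms(1)] by (simp add: lborel_prod)
  have g_m [measurable]: "case_prod g \<in> borel_measurable (lborel \<Otimes>\<^sub>M lborel)"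
    unfolding g_def by measurable
  have inner: "(\<integral>\<^sup>+u. g \<xi> u \<partial>lborel) = ennreal (\<epsilon> / 2) * (\<integral>\<^sup>+\<zeta>. h (char_point c \<epsilon> (\<xi>, \<zeta>)) \<partial>lborel)" for \<xi>
  proof -
    have "(\<integral>\<^sup>+u. g \<xi> u \<partial>lborel) = \<bar>\<epsilon> / 2\<bar> * (\<integral>\<^sup>+\<zeta>. g \<xi> (fst c + \<epsilon> * \<xi> / 2 + \<epsilon> / 2 * \<zeta>) \<partial>lborel)"
      using \<open>0 < \<epsilon>\<close> by (intro nn_integral_real_affine) (auto simp: g_def)
    also have "(\<lambda>\<zeta>. g \<xi> (fst c + \<epsilon> * \<xi> / 2 + \<epsilon> / 2 * \<zeta>)) = (\<lambda>\<zeta>. h (char_point c \<epsilon> (\<xi>, \<zeta>)))"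
      unfolding g_def char_point_def
      by (intro ext arg_cong[where f = h]) (auto simp: prod_eq_iff field_simps)
    finally show ?thesis
      using \<open>0 < \<epsilon>\<close> by simp
  qed
  have outer: "(\<integral>\<^sup>+v. h (u, v) \<partial>lborel) = ennreal \<epsilon> * (\<integral>\<^sup>+\<xi>. g \<xi> u \<partial>lborel)" for u
    using nn_integral_real_affine[of "\<lambda>v. h (u, v)" \<epsilon> "fst c + snd c - u"] \<open>0 < \<epsilon>\<close>
    by (simp add: g_def algebra_simps)
  have "(\<integral>\<^sup>+p. h p \<partial>lborel) = (\<integral>\<^sup>+u. \<integral>\<^sup>+v. h (u, v) \<partial>lborel \<partial>lborel)"
    by (subst lborel.nn_integral_fst) (auto simp: lborel_prod)
  also have "\<dots> = ennreal \<epsilon> * (\<integral>\<^sup>+u. \<integral>\<^sup>+\<xi>. g \<xi> u \<partial>lborel \<partial>lborel)"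
    unfolding outer by (rule nn_integral_cmult) measurable
  also have "(\<integral>\<^sup>+u. \<integral>\<^sup>+\<xi>. g \<xi> u \<partial>lborel \<partial>lborel) = (\<integral>\<^sup>+\<xi>. \<integral>\<^sup>+u. g \<xi> u \<partial>lborel \<partial>lborel)"
    by (rule lborel_pair.Fubini'[OF g_m])
  also have "\<dots> = ennreal (\<epsilon> / 2) * (\<integral>\<^sup>+\<xi>. \<integral>\<^sup>+\<zeta>. h (char_point c \<epsilon> (\<xi>, \<zeta>)) \<partial>lborel \<partial>lborel)"
    unfolding inner by (rule nn_integral_cmult) measurable
  also have "(\<integral>\<^sup>+\<xi>. \<integral>\<^sup>+\<zeta>. h (char_point c \<epsilon> (\<xi>, \<zeta>)) \<partial>lborel \<partial>lborel) = (\<integral>\<^sup>+z. h (char_point c \<epsilon> z) \<partial>lborel)"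
    by (subst lborel.nn_integral_fst[OF cp]) (auto simp: lborel_prod)
  also have "ennreal \<epsilon> * (ennreal (\<epsilon> / 2) * (\<integral>\<^sup>+z. h (char_point c \<epsilon> z) \<partial>lborel)) =
      ennreal (\<epsilon>\<^sup>2 / 2) * (\<integral>\<^sup>+z. h (char_point c \<epsilon> z) \<partial>lborel)"
    using \<open>0 < \<epsilon>\<close> by (simp add: mult.assoc[symmetric] ennreal_mult[symmetric] power2_eq_square)
  finally show ?thesis .
qed

text \<open>Phrased as an identity of measures, the substitution passes to real functions that are
  merely measurable, without a check of integrability.\<close>

lemma integral_char_point:
  fixes h :: "plane \<Rightarrow> real"
  assumes [measurable]: "h \<in> borel_measurable borel" and "0 < \<epsilon>"
  shows "(\<integral>p. h p \<partial>lborel) = \<epsilon>\<^sup>2 / 2 * (\<integral>z. h (char_point c \<epsilon> z) \<partial>lborel)"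
proof -
  have "lborel = density (distr lborel borel (char_point c \<epsilon>)) (\<lambda>_. ennreal (\<epsilon>\<^sup>2 / 2))"
  proof (rule measure_eqI)
    fix A assume "A \<in> sets (lborel :: plane measure)"
    then have [measurable]: "A \<in> sets borel"
      by simp
    have "emeasure lborel A = (\<integral>\<^sup>+p. indicator A p \<partial>lborel)"
      by simp
    also have "\<dots> = ennreal (\<epsilon>\<^sup>2 / 2) * (\<integral>\<^sup>+z. indicator A (char_point c \<epsilon> z) \<partial>lborel)"
      by (rule nn_integral_char_point) (use assms in auto)
    also have "\<dots> = (\<integral>\<^sup>+p. ennreal (\<epsilon>\<^sup>2 / 2) * indicator A p \<partial>distr lborel borel (char_point c \<epsilon>))"
      by (subst nn_integral_distr) (auto intro!: nn_integral_cmult[symmetric])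
    finally show "emeasure lborel A = emeasure (density (distr lborel borel (char_point c \<epsilon>)) (\<lambda>_. ennreal (\<epsilon>\<^sup>2 / 2))) A"
      by (simp add: emeasure_density)
  qed simp
  then have "(\<integral>p. h p \<partial>lborel) =
      (\<integral>p. h p \<partial>density (distr lborel borel (char_point c \<epsilon>)) (\<lambda>_. ennreal (\<epsilon>\<^sup>2 / 2)))"
    by simp
  also have "\<dots> = \<epsilon>\<^sup>2 / 2 * (\<integral>z. h (char_point c \<epsilon> z) \<partial>lborel)"
    by (simp add: integral_density integral_distr)
  finally show ?thesis .
qed

section \<open>Moments of bumps and of their products\<close>

lemma integral_lborel_times:
  fixes f g :: "real \<Rightarrow> real"
  assumes "integrable lborel f" "integrable lborel g"
  shows "integrable lborel (\<lambda>z. f (fst z) * g (snd z))"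
    and "(\<integral>z. f (fst z) * g (snd z) \<partial>lborel) = (\<integral>x. f x \<partial>lborel) * (\<integral>y. g y \<partial>lborel)"
proof -
  have [measurable]: "f \<in> borel_measurable borel" "g \<in> borel_measurable borel"
    using assms by (auto dest!: borel_measurable_integrable)
  have "integrable (lborel \<Otimes>\<^sub>M lborel) (\<lambda>z. f (fst z) * g (snd z))"
    using assms by (intro lborel_pair.Fubini_integrable) (auto simp: abs_mult intro!: integrable_mult_left)
  note i = this
  then show "integrable lborel (\<lambda>z. f (fst z) * g (snd z))"
    by (simp add: lborel_prod)
  show "(\<integral>z. f (fst z) * g (snd z) \<partial>lborel) = (\<integral>x. f x \<partial>lborel) * (\<integral>y. g y \<partial>lborel)"
    using lborel_pair.integral_fst'[OF i] by (simp add: lborel_prod)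
qed

lemma integral_bump_shift: "(\<integral>x. bump (x - s) \<partial>lborel) = bump_mass"
  using lborel_integral_real_affine[of 1 bump "- s"] by (simp add: bump_mass_def)

text \<open>By evenness the first moment of \<open>bump\<close> vanishes, so translation moves the
  centre of mass to \<open>s\<close>.\<close>

lemma integral_id_bump_shift: "(\<integral>x. x * bump (x - s) \<partial>lborel) = s * bump_mass"
proof -
  have i: "integrable lborel (\<lambda>x. x * bump x)"
    using integrable_continuous_bump[of "\<lambda>x. x" 0] by (simp add: continuous_intros)
  have "(\<integral>x. x * bump x \<partial>lborel) = 0"
    using lborel_integral_real_affine[of "-1" "\<lambda>x. x * bump x" 0] by (simp add: bump_even)
  then have "(\<integral>x. x * bump x + s * bump x \<partial>lborel) = s * bump_mass"
    by (simp add: bump_mass_def i integrable_bump)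
  moreover have "(\<integral>x. x * bump (x - s) \<partial>lborel) = (\<integral>x. (s + x) * bump x \<partial>lborel)"
    using lborel_integral_real_affine[of 1 "\<lambda>x. x * bump (x - s)" s] by simp
  ultimately show ?thesis
    by (simp add: algebra_simps)
qed

definition bump2 :: "real \<Rightarrow> real \<Rightarrow> plane \<Rightarrow> real" where
  "bump2 s t z = bump (fst z - s) * bump (snd z - t)"

lemma bump2_nonneg: "bump2 s t z \<ge> 0"
  by (simp add: bump2_def bump_nonneg)

lemma continuous_bump: "continuous_on S bump"
  by (rule smooth_continuous[OF smooth_bump])

lemma continuous_bump2: "continuous_on S (bump2 s t)"
  unfolding bump2_def[abs_def]
  by (intro continuous_intros continuous_on_compose2[OF continuous_bump[of UNIV]]) auto

lemma bump2_nonzeroD: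
  assumes "bump2 s t z \<noteq> 0" shows "\<bar>fst z - s\<bar> < 1" "\<bar>snd z - t\<bar> < 1"
  using assms bump_eq_0 by (force simp: bump2_def not_less[symmetric])+

lemma bump2_support: "norm z > 2 + \<bar>s\<bar> + \<bar>t\<bar> \<Longrightarrow> bump2 s t z = 0"
  using bump2_nonzeroD[of s t z] norm_Pair_le[of "fst z" "snd z"] by fastforce

lemma integrable_continuous_bump2:
  assumes "continuous_on UNIV f"
  shows "integrable lborel (\<lambda>z. f z * bump2 s t z)"
  by (rule integrable_continuous_compact_support[where R = "2 + \<bar>s\<bar> + \<bar>t\<bar>"])
     (auto intro!: continuous_intros continuous_bump2 assms simp: bump2_support)

text \<open>The weight has its centre of mass at \<open>(s, t)\<close>, so affine functions are
  averaged without error; in a Taylor expansion only the second-order remainder costs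
  something.\<close>

lemma integral_affine_bump2:
  "(\<integral>z. (a + b * fst z + d * snd z) * bump2 s t z \<partial>lborel) = (a + b * s + d * t) * bump_mass\<^sup>2"
proof -
  have i: "integrable lborel (\<lambda>x. bump (x - r))" "integrable lborel (\<lambda>x. x * bump (x - r))" for r
    using integrable_continuous_bump[of "\<lambda>_. 1" r] integrable_continuous_bump[of "\<lambda>x. x" r]
    by (simp_all add: continuous_intros)
  note l = integral_lborel_times
  have "(\<integral>z. (a + b * fst z + d * snd z) * bump2 s t z \<partial>lborel) =
     (\<integral>z. a * (bump (fst z - s) * bump (snd z - t)) + b * ((fst z * bump (fst z - s)) * bump (snd z - t))
        + d * (bump (fst z - s) * (snd z * bump (snd z - t))) \<partial>lborel)"
    by (intro Bochner_Integration.integral_cong) (auto simp: bump2_def algebra_simps)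
  also have "\<dots> = a * (bump_mass * bump_mass) + b * ((s * bump_mass) * bump_mass)
        + d * (bump_mass * (t * bump_mass))"
    by (simp add: l(1)[OF i(1) i(1)] l(1)[OF i(2) i(1)] l(1)[OF i(1) i(2)]
        l(2)[OF i(1) i(1)] l(2)[OF i(2) i(1)] l(2)[OF i(1) i(2)] integral_bump_shift integral_id_bump_shift)
  finally show ?thesis
    by (simp add: power2_eq_square algebra_simps)
qed

text \<open>A single induction over the generation of polynomials provides the expansion together
  with partial derivatives that are again polynomials, so that the lemma can be applied to them in
  turn. The remainder is continuous in \<open>(\<epsilon>, h)\<close>, hence bounded on compact sets
  uniformly in \<epsilon>.\<close>

lemma real_polynomial_function_taylor:
  fixes q :: "plane \<Rightarrow> real"
  assumes "real_polynomial_function q"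
  shows "\<exists>qx qy. real_polynomial_function qx \<and> real_polynomial_function qy \<and>
    (\<forall>p. (q has_derivative (\<lambda>h. qx p * fst h + qy p * snd h)) (at p)) \<and>
    (\<forall>c. \<exists>R. continuous_on UNIV R \<and>
       (\<forall>\<epsilon> h. q (c + \<epsilon> *\<^sub>R h) = q c + \<epsilon> * (qx c * fst h + qy c * snd h) + \<epsilon>\<^sup>2 * R (\<epsilon>, h)))"
  using assms
proof induction
  case (linear f)
  interpret f: bounded_linear f by fact
  have f: "f h = f (1, 0) * fst h + f (0, 1) * snd h" for h
    using f.add[of "fst h *\<^sub>R (1, 0)" "snd h *\<^sub>R (0, 1)"] f.scaleR[of "fst h" "(1, 0)"] f.scaleR[of "snd h" "(0, 1)"]
    by simp
  have "(f has_derivative (\<lambda>h. f (1, 0) * fst h + f (0, 1) * snd h)) (at p)" for p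
    using bounded_linear_imp_has_derivative[OF linear.hyps] by (rule has_derivative_eq_rhs) (rule ext, rule f)
  then show ?case
    by (intro exI[of _ "\<lambda>_. f (1, 0)"] exI[of _ "\<lambda>_. f (0, 1)"] conjI allI exI[of _ "\<lambda>_. 0"])
       (auto simp: f.add f.scaleR f[symmetric])
next
  case (const a)
  show ?case
    by (intro exI[of _ "\<lambda>_. 0"] conjI allI) (auto intro!: exI[of _ "\<lambda>_. 0"])
next
  case (add f g)
  then obtain fx fy gx gy where p: "real_polynomial_function fx" "real_polynomial_function fy"
      "real_polynomial_function gx" "real_polynomial_function gy"
    and d: "\<And>p. (f has_derivative (\<lambda>h. fx p * fst h + fy p * snd h)) (at p)"
      "\<And>p. (g has_derivative (\<lambda>h. gx p * fst h + gy p * snd h)) (at p)"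
    and t: "\<And>c. \<exists>R. continuous_on UNIV R \<and>
       (\<forall>\<epsilon> h. f (c + \<epsilon> *\<^sub>R h) = f c + \<epsilon> * (fx c * fst h + fy c * snd h) + \<epsilon>\<^sup>2 * R (\<epsilon>, h))"
      "\<And>c. \<exists>R. continuous_on UNIV R \<and>
       (\<forall>\<epsilon> h. g (c + \<epsilon> *\<^sub>R h) = g c + \<epsilon> * (gx c * fst h + gy c * snd h) + \<epsilon>\<^sup>2 * R (\<epsilon>, h))"
    by blast
  show ?case
  proof (rule exI[of _ "\<lambda>p. fx p + gx p"], rule exI[of _ "\<lambda>p. fy p + gy p"], intro conjI allI)
    show "((\<lambda>p. f p + g p) has_derivative (\<lambda>h. (fx p + gx p) * fst h + (fy p + gy p) * snd h)) (at p)" for p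
      using has_derivative_add[OF d, of p] by (simp add: algebra_simps)
    fix c
    obtain R S where "continuous_on UNIV R" "continuous_on UNIV S"
      and "\<And>\<epsilon> h. f (c + \<epsilon> *\<^sub>R h) = f c + \<epsilon> * (fx c * fst h + fy c * snd h) + \<epsilon>\<^sup>2 * R (\<epsilon>, h)"
        "\<And>\<epsilon> h. g (c + \<epsilon> *\<^sub>R h) = g c + \<epsilon> * (gx c * fst h + gy c * snd h) + \<epsilon>\<^sup>2 * S (\<epsilon>, h)"
      using t by metis
    then show "\<exists>R. continuous_on UNIV R \<and> (\<forall>\<epsilon> h. f (c + \<epsilon> *\<^sub>R h) + g (c + \<epsilon> *\<^sub>R h) =
        f c + g c + \<epsilon> * ((fx c + gx c) * fst h + (fy c + gy c) * snd h) + \<epsilon>\<^sup>2 * R (\<epsilon>, h))"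
      by (intro exI[of _ "\<lambda>z. R z + S z"]) (auto intro!: continuous_intros simp: algebra_simps)
  qed (use p in auto)
next
  case (mult f g)
  then obtain fx fy gx gy where p: "real_polynomial_function fx" "real_polynomial_function fy"
      "real_polynomial_function gx" "real_polynomial_function gy"
    and d: "\<And>p. (f has_derivative (\<lambda>h. fx p * fst h + fy p * snd h)) (at p)"
      "\<And>p. (g has_derivative (\<lambda>h. gx p * fst h + gy p * snd h)) (at p)"
    and t: "\<And>c. \<exists>R. continuous_on UNIV R \<and>
       (\<forall>\<epsilon> h. f (c + \<epsilon> *\<^sub>R h) = f c + \<epsilon> * (fx c * fst h + fy c * snd h) + \<epsilon>\<^sup>2 * R (\<epsilon>, h))"
      "\<And>c. \<exists>R. continuous_on UNIV R \<and>
       (\<forall>\<epsilon> h. g (c + \<epsilon> *\<^sub>R h) = g c + \<epsilon> * (gx c * fst h + gy c * snd h) + \<epsilon>\<^sup>2 * R (\<epsilon>, h))"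
    by blast
  show ?case
  proof (rule exI[of _ "\<lambda>p. f p * gx p + fx p * g p"], rule exI[of _ "\<lambda>p. f p * gy p + fy p * g p"], intro conjI allI)
    show "((\<lambda>p. f p * g p) has_derivative
        (\<lambda>h. (f p * gx p + fx p * g p) * fst h + (f p * gy p + fy p * g p) * snd h)) (at p)" for p
      using has_derivative_mult[OF d, of p] by (simp add: algebra_simps)
    fix c
    obtain R S where c: "continuous_on UNIV R" "continuous_on UNIV S"
      and R: "\<And>\<epsilon> h. f (c + \<epsilon> *\<^sub>R h) = f c + \<epsilon> * (fx c * fst h + fy c * snd h) + \<epsilon>\<^sup>2 * R (\<epsilon>, h)"
      and S: "\<And>\<epsilon> h. g (c + \<epsilon> *\<^sub>R h) = g c + \<epsilon> * (gx c * fst h + gy c * snd h) + \<epsilon>\<^sup>2 * S (\<epsilon>, h)"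
      using t by metis
    define Df Dg where "Df = (\<lambda>h. fx c * fst h + fy c * snd h)" and "Dg = (\<lambda>h. gx c * fst h + gy c * snd h)"
    have cD: "continuous_on UNIV Df" "continuous_on UNIV Dg"
      by (auto simp: Df_def Dg_def intro!: continuous_intros)
    \<comment> \<open>\<open>Q\<close> collects the terms of order two, three and four in \<epsilon>
      from the product of the two expansions.\<close>
    define Q where "Q = (\<lambda>z. f c * S z + g c * R z + Df (snd z) * Dg (snd z)
       + fst z * (Df (snd z) * S z + Dg (snd z) * R z) + (fst z)\<^sup>2 * R z * S z)"
    have "continuous_on UNIV Q"
      unfolding Q_def
      by (intro continuous_intros c continuous_on_compose2[OF cD(1)] continuous_on_compose2[OF cD(2)]) auto
    moreover have "f (c + \<epsilon> *\<^sub>R h) * g (c + \<epsilon> *\<^sub>R h) =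
        f c * g c + \<epsilon> * ((f c * gx c + fx c * g c) * fst h + (f c * gy c + fy c * g c) * snd h)
        + \<epsilon>\<^sup>2 * Q (\<epsilon>, h)" for \<epsilon> h
      unfolding R S Q_def Df_def Dg_def fst_conv snd_conv by algebra
    ultimately show "\<exists>R. continuous_on UNIV R \<and> (\<forall>\<epsilon> h. f (c + \<epsilon> *\<^sub>R h) * g (c + \<epsilon> *\<^sub>R h) =
        f c * g c + \<epsilon> * ((f c * gx c + fx c * g c) * fst h + (f c * gy c + fy c * g c) * snd h)
        + \<epsilon>\<^sup>2 * R (\<epsilon>, h))"
      by blast
  qed (use p mult.hyps in auto)
qed

text \<open>The affine part is averaged exactly, and the remainder contributes \<epsilon>^2 times a
  bounded integral, which is still O(\<epsilon>) after the division. The displacement that belongs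
  to the centre \<open>(s, t)\<close> is \<open>((s + t) / 2, (s - t) / 2)\<close>.\<close>

lemma bump2_average_taylor:
  fixes q :: "plane \<Rightarrow> real" and \<epsilon> :: "nat \<Rightarrow> real"
  assumes R: "continuous_on UNIV R"
    and q: "\<And>\<epsilon> h. q (c + \<epsilon> *\<^sub>R h) = q c + \<epsilon> * (a * fst h + b * snd h) + \<epsilon>\<^sup>2 * R (\<epsilon>, h)"
    and \<epsilon>: "\<epsilon> \<longlonglongrightarrow> 0" "\<And>n. 0 < \<epsilon> n" "\<And>n. \<epsilon> n \<le> 1"
  shows "(\<lambda>n. ((\<integral>z. q (char_point c (\<epsilon> n) z) * bump2 s t z \<partial>lborel)
      - (q c + \<epsilon> n * (a * (s + t) / 2 + b * (s - t) / 2)) * bump_mass\<^sup>2) / \<epsilon> n) \<longlonglongrightarrow> 0"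
proof -
  define W where "W = (\<lambda>z::plane. ((fst z + snd z) / 2, (fst z - snd z) / 2))"
  have cW: "continuous_on S W" for S
    unfolding W_def by (intro continuous_intros) auto
  have cR: "continuous_on UNIV (\<lambda>z. R (e, W z))" for e
    by (intro continuous_on_compose2[OF R] continuous_intros cW) auto
  define B where "B = cball (0::plane) (2 + \<bar>s\<bar> + \<bar>t\<bar>)"
  \<comment> \<open>The scales lie between 0 and 1 and the weight has compact support, so one bound
    \<open>M\<close> for the remainder serves all \<open>n\<close>.\<close>
  have "compact ({0..1::real} \<times> W ` B)"
    unfolding B_def by (intro compact_Times compact_continuous_image cW) auto
  then have "compact (R ` ({0..1} \<times> W ` B))"
    by (intro compact_continuous_image continuous_on_subset[OF R]) auto
  then obtain M where M: "\<And>e z. e \<in> {0..1} \<Longrightarrow> z \<in> B \<Longrightarrow> \<bar>R (e, W z)\<bar> \<le> M"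
    using compact_imp_bounded[of "R ` ({0..1} \<times> W ` B)"] unfolding bounded_iff by fastforce
  have "((\<integral>z. q (char_point c (\<epsilon> n) z) * bump2 s t z \<partial>lborel)
      - (q c + \<epsilon> n * (a * (s + t) / 2 + b * (s - t) / 2)) * bump_mass\<^sup>2) / \<epsilon> n
      = \<epsilon> n * (\<integral>z. R (\<epsilon> n, W z) * bump2 s t z \<partial>lborel)" for n
  proof -
    have e: "q (char_point c (\<epsilon> n) z) = q c + \<epsilon> n * (a * ((fst z + snd z) / 2) + b * ((fst z - snd z) / 2))
        + (\<epsilon> n)\<^sup>2 * R (\<epsilon> n, W z)" for z
      using q[of "\<epsilon> n" "W z"] by (simp add: char_point_def W_def)
    have "(\<integral>z. q (char_point c (\<epsilon> n) z) * bump2 s t z \<partial>lborel) =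
       (\<integral>z. (q c + (\<epsilon> n * (a + b) / 2) * fst z + (\<epsilon> n * (a - b) / 2) * snd z) * bump2 s t z
          + (\<epsilon> n)\<^sup>2 * (R (\<epsilon> n, W z) * bump2 s t z) \<partial>lborel)"
      by (simp add: e field_simps)
    also have "\<dots> = (q c + (\<epsilon> n * (a + b) / 2) * s + (\<epsilon> n * (a - b) / 2) * t) * bump_mass\<^sup>2
        + (\<epsilon> n)\<^sup>2 * (\<integral>z. R (\<epsilon> n, W z) * bump2 s t z \<partial>lborel)"
      by (subst Bochner_Integration.integral_add)
         (auto simp: integral_affine_bump2[where b = "\<epsilon> n * (a + b) / 2" and d = "\<epsilon> n * (a - b) / 2", simplified] cR
           intro!: integrable_continuous_bump2 continuous_intros)
    also have "q c + (\<epsilon> n * (a + b) / 2) * s + (\<epsilon> n * (a - b) / 2) * t =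
        q c + \<epsilon> n * (a * (s + t) / 2 + b * (s - t) / 2)"
      by (simp add: field_simps)
    finally show ?thesis
      using \<epsilon>(2)[of n] by (simp add: power2_eq_square)
  qed
  moreover have "(\<lambda>n. \<epsilon> n * (\<integral>z. R (\<epsilon> n, W z) * bump2 s t z \<partial>lborel)) \<longlonglongrightarrow> 0"
  proof (rule Lim_null_comparison)
    show "\<forall>\<^sub>F n in sequentially. norm (\<epsilon> n * (\<integral>z. R (\<epsilon> n, W z) * bump2 s t z \<partial>lborel))
        \<le> \<epsilon> n * (M * bump_mass\<^sup>2)"
    proof (rule always_eventually, rule allI)
      fix n
      have "norm (\<integral>z. R (\<epsilon> n, W z) * bump2 s t z \<partial>lborel) \<le> (\<integral>z. M * bump2 s t z \<partial>lborel)"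
      proof (rule Bochner_Integration.integral_norm_bound_integral)
        show "integrable lborel (\<lambda>z. R (\<epsilon> n, W z) * bump2 s t z)" "integrable lborel (\<lambda>z. M * bump2 s t z)"
          by (intro integrable_continuous_bump2 cR continuous_intros)+
        show "norm (R (\<epsilon> n, W z) * bump2 s t z) \<le> M * bump2 s t z" for z
        proof (cases "z \<in> B")
          case True
          then show ?thesis
            using M[of "\<epsilon> n" z] \<epsilon>(2,3)[of n] bump2_nonneg[of s t z]
            by (auto simp: abs_mult intro!: mult_right_mono)
        next
          case False
          then show ?thesis
            using bump2_support[of s t z] by (simp add: B_def)
        qed
      qed
      also have "\<dots> = M * bump_mass\<^sup>2"
        using integral_affine_bump2[of M 0 0 s t] by simp
      finally show "norm (\<epsilon> n * (\<integral>z. R (\<epsilon> n, W z) * bump2 s t z \<partial>lborel)) \<le> \<epsilon> n * (M * bump_mass\<^sup>2)"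
        using \<epsilon>(2)[of n] by (simp add: abs_mult)
    qed
    show "(\<lambda>n. \<epsilon> n * (M * bump_mass\<^sup>2)) \<longlonglongrightarrow> 0"
      using tendsto_mult_left_zero[OF \<epsilon>(1)] by simp
  qed
  ultimately show ?thesis
    by simp
qed

section \<open>Jump conditions across a noncharacteristic line\<close>

text \<open>The area of the disc gives the norm of \<open>\<phi> n\<close> the order \<epsilon>, and
  dominated convergence makes the norm of \<open>f\<close> over the disc tend to 0. The estimate of
  Cauchy-Schwarz type comes from a weighted arithmetic-geometric mean inequality applied
  pointwise.\<close>

lemma L2_pairing_small_support:
  fixes f :: "plane \<Rightarrow> real" and \<phi> :: "nat \<Rightarrow> plane \<Rightarrow> real" and \<epsilon> :: "nat \<Rightarrow> real"
  assumes "open \<Omega>" "f \<in> L2 \<Omega>" and \<epsilon>: "\<epsilon> \<longlonglongrightarrow> 0" "\<And>n. 0 < \<epsilon> n" and "0 \<le> \<rho>"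
    and bound: "\<And>n p. \<bar>\<phi> n p\<bar> \<le> M" and support: "\<And>n p. p \<notin> cball c (\<rho> * \<epsilon> n) \<Longrightarrow> \<phi> n p = 0"
    and \<phi> [measurable]: "\<And>n. \<phi> n \<in> borel_measurable borel"
  shows "(\<lambda>n. (\<integral>p. f p * \<phi> n p \<partial>lebesgue_on \<Omega>) / \<epsilon> n) \<longlonglongrightarrow> 0"
proof -
  define N where "N = lebesgue_on \<Omega>"
  define B where "B = (\<lambda>n. cball c (\<rho> * \<epsilon> n))"
  have \<Omega>: "\<Omega> \<in> sets lebesgue"
    using \<open>open \<Omega>\<close> by simp
  have borel_N: "g \<in> borel_measurable N" if "g \<in> borel_measurable borel" for g :: "plane \<Rightarrow> real"
    unfolding N_def using that by (intro measurable_restrict_space1 measurable_completion) simp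
  have f [measurable]: "f \<in> borel_measurable N" and f2: "integrable N (\<lambda>p. (f p)\<^sup>2)"
    using \<open>f \<in> L2 \<Omega>\<close> by (auto simp: L2_def N_def)
  have B_N [measurable]: "(\<lambda>p. indicator (B n) p :: real) \<in> borel_measurable N" for n
    unfolding B_def by (rule borel_N) (intro borel_measurable_indicator borel_closed closed_cball)
  have \<phi>_N [measurable]: "\<phi> n \<in> borel_measurable N" for n
    by (rule borel_N) simp
  define a where "a = (\<lambda>n. \<integral>p. indicator (B n) p * (f p)\<^sup>2 \<partial>N)"
  have am [measurable]: "(\<lambda>p. indicator (B n) p * (f p)\<^sup>2) \<in> borel_measurable N" for n
    by (intro borel_measurable_times borel_measurable_power B_N f)
  have ia: "integrable N (\<lambda>p. indicator (B n) p * (f p)\<^sup>2)" for n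
    by (rule Bochner_Integration.integrable_bound[OF f2 am]) (simp add: indicator_def)
  have a_nonneg: "a n \<ge> 0" for n
    unfolding a_def by (rule integral_nonneg_AE) simp
  have "a \<longlonglongrightarrow> (\<integral>p. 0 \<partial>N)"
    unfolding a_def
  proof (rule integral_dominated_convergence[OF _ _ f2])
    \<comment> \<open>At \<open>c\<close> itself the indicators stay 1, so this point has to be
      excluded.\<close>
    have "AE p in N. p \<noteq> c"
      using AE_completion[OF AE_lborel_singleton[of c]] \<Omega> unfolding N_def
      by (auto simp: AE_restrict_space_iff elim: eventually_mono)
    then show "AE p in N. (\<lambda>n. indicator (B n) p * (f p)\<^sup>2) \<longlonglongrightarrow> 0"
    proof eventually_elim
      case (elim p)
      have "(\<lambda>n. \<rho> * \<epsilon> n) \<longlonglongrightarrow> 0"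
        using tendsto_mult_right_zero[OF \<epsilon>(1)] .
      then have "\<forall>\<^sub>F n in sequentially. \<rho> * \<epsilon> n < dist c p"
        using elim by (intro order_tendstoD) auto
      then have "\<forall>\<^sub>F n in sequentially. indicator (B n) p * (f p)\<^sup>2 = 0"
        by eventually_elim (auto simp: B_def)
      then show ?case
        by (rule tendsto_eventually)
    qed
  qed (rule am | simp add: indicator_def)+
  then have a: "a \<longlonglongrightarrow> 0"
    by simp
  \<comment> \<open>\<open>M\<^sup>2\<close> times the area of the disc, with
    \<open>(\<epsilon> n)\<^sup>2\<close> split off.\<close>
  define C where "C = M\<^sup>2 * (unit_ball_vol 2 * \<rho>\<^sup>2)"
  have b: "integrable N (\<lambda>p. (\<phi> n p)\<^sup>2)" "(\<integral>p. (\<phi> n p)\<^sup>2 \<partial>N) \<le> C * (\<epsilon> n)\<^sup>2" for n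
  proof -
    have c: "(\<phi> n p)\<^sup>2 \<le> M\<^sup>2 * indicator (B n) p" for p
      using bound[of n p] support[of p n] by (auto simp: indicator_def B_def abs_le_square_iff[symmetric])
    have "integrable lborel (indicator (B n) :: plane \<Rightarrow> real)"
      unfolding B_def by (rule integrable_real_indicator[OF _ emeasure_lborel_cball_finite]) simp
    then have "integrable lebesgue (indicator (B n) :: plane \<Rightarrow> real)"
      by (subst integrable_completion) (auto simp: B_def)
    then have il: "integrable lebesgue (\<lambda>p. M\<^sup>2 * indicator (B n) p :: real)"
      by (rule integrable_mult_right)
    have "(\<lambda>p. indicator \<Omega> p *\<^sub>R (\<phi> n p)\<^sup>2) \<in> borel_measurable lebesgue"
      by (intro borel_measurable_scaleR borel_measurable_indicator \<Omega> borel_measurable_power measurable_completion) simp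
    moreover have "norm (indicator \<Omega> p *\<^sub>R (\<phi> n p)\<^sup>2) \<le> norm (M\<^sup>2 * indicator (B n) p)" for p
      using c[of p] by (cases "p \<in> \<Omega>") (auto simp: indicator_def)
    ultimately have ie: "integrable lebesgue (\<lambda>p. indicator \<Omega> p *\<^sub>R (\<phi> n p)\<^sup>2)"
      by (intro Bochner_Integration.integrable_bound[OF il] AE_I2)
    then show "integrable N (\<lambda>p. (\<phi> n p)\<^sup>2)"
      unfolding N_def using \<Omega> by (simp add: integrable_restrict_space)
    have "(\<integral>p. (\<phi> n p)\<^sup>2 \<partial>N) = (\<integral>p. indicator \<Omega> p *\<^sub>R (\<phi> n p)\<^sup>2 \<partial>lebesgue)"
      unfolding N_def using \<Omega> by (simp add: integral_restrict_space)
    also have "\<dots> \<le> (\<integral>p. M\<^sup>2 * indicator (B n) p \<partial>lebesgue)"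
    proof (rule integral_mono[OF ie il])
      show "indicator \<Omega> p *\<^sub>R (\<phi> n p)\<^sup>2 \<le> M\<^sup>2 * indicator (B n) p" for p
        using c[of p] by (cases "p \<in> \<Omega>") (auto simp: indicator_def)
    qed
    also have "\<dots> = (\<integral>p. M\<^sup>2 * indicator (B n) p \<partial>lborel)"
      unfolding B_def
      by (intro integral_completion borel_measurable_times borel_measurable_const borel_measurable_indicator) simp
    also have "\<dots> = C * (\<epsilon> n)\<^sup>2"
      using \<open>0 \<le> \<rho>\<close> \<epsilon>(2)[of n] by (simp add: B_def C_def content_cball power2_eq_square)
    finally show "(\<integral>p. (\<phi> n p)\<^sup>2 \<partial>N) \<le> C * (\<epsilon> n)\<^sup>2" .
  qed
  have "norm ((\<integral>p. f p * \<phi> n p \<partial>N) / \<epsilon> n) \<le> sqrt (a n) + C * (sqrt (a n) + \<epsilon> n)" for n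
  proof -
    \<comment> \<open>Up to a constant the best weight is \<open>sqrt (a n)\<close>; the summand
      \<open>\<epsilon> n\<close> keeps it positive when \<open>a n = 0\<close>.\<close>
    define \<kappa> where "\<kappa> = sqrt (a n) + \<epsilon> n"
    have \<kappa>: "\<kappa> > 0" "sqrt (a n) \<le> \<kappa>"
      using a_nonneg[of n] \<epsilon>(2)[of n] by (auto simp: \<kappa>_def intro: add_nonneg_pos)
    have e: "0 < \<epsilon> n"
      by (rule \<epsilon>)
    define w where "w = (\<lambda>p. \<epsilon> n / \<kappa> * (indicator (B n) p * (f p)\<^sup>2) + \<kappa> / \<epsilon> n * (\<phi> n p)\<^sup>2)"
    have w: "norm (f p * \<phi> n p) \<le> w p" for p
    proof (cases "p \<in> B n")
      case True
      define x y where "x = \<bar>f p\<bar>" and "y = \<bar>\<phi> n p\<bar>"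
      have "0 \<le> (\<epsilon> n * x - \<kappa> * y)\<^sup>2" "0 \<le> x * y * (\<kappa> * \<epsilon> n)"
        using \<kappa> e by (auto simp: x_def y_def)
      then have "x * y * (\<kappa> * \<epsilon> n) \<le> (\<epsilon> n)\<^sup>2 * x\<^sup>2 + \<kappa>\<^sup>2 * y\<^sup>2"
        by (simp add: power2_diff power_mult_distrib mult_ac)
      then have "x * y \<le> ((\<epsilon> n)\<^sup>2 * x\<^sup>2 + \<kappa>\<^sup>2 * y\<^sup>2) / (\<kappa> * \<epsilon> n)"
        using \<kappa> e by (simp add: pos_le_divide_eq)
      also have "\<dots> = \<epsilon> n / \<kappa> * x\<^sup>2 + \<kappa> / \<epsilon> n * y\<^sup>2"
        using \<kappa> e by (simp add: add_divide_distrib power2_eq_square)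
      finally show ?thesis
        using True by (simp add: w_def x_def y_def abs_mult)
    next
      case False
      then have "\<phi> n p = 0"
        using support by (simp add: B_def)
      with False show ?thesis
        by (simp add: w_def)
    qed
    have iw: "integrable N w"
      unfolding w_def using ia b(1) by auto
    have "integrable N (\<lambda>p. f p * \<phi> n p)"
    proof (rule Bochner_Integration.integrable_bound[OF iw])
      show "(\<lambda>p. f p * \<phi> n p) \<in> borel_measurable N"
        by (intro borel_measurable_times f \<phi>_N)
      show "AE p in N. norm (f p * \<phi> n p) \<le> norm (w p)"
        by (intro AE_I2 order_trans[OF w]) simp
    qed
    then have "norm (\<integral>p. f p * \<phi> n p \<partial>N) \<le> (\<integral>p. w p \<partial>N)"
      by (rule Bochner_Integration.integral_norm_bound_integral[OF _ iw]) (rule w)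
    also have "\<dots> = \<epsilon> n / \<kappa> * a n + \<kappa> / \<epsilon> n * (\<integral>p. (\<phi> n p)\<^sup>2 \<partial>N)"
      unfolding w_def a_def using ia b(1) by simp
    also have "\<dots> \<le> \<epsilon> n * sqrt (a n) + \<epsilon> n * (C * \<kappa>)"
    proof (rule add_mono)
      have "a n = sqrt (a n) * sqrt (a n)"
        using a_nonneg by simp
      also have "\<dots> \<le> sqrt (a n) * \<kappa>"
        using \<kappa> a_nonneg by (intro mult_left_mono) auto
      finally have "a n / \<kappa> \<le> sqrt (a n)"
        using \<kappa> by (simp add: pos_divide_le_eq)
      then show "\<epsilon> n / \<kappa> * a n \<le> \<epsilon> n * sqrt (a n)"
        using e by (metis mult_left_mono less_imp_le times_divide_eq_left times_divide_eq_right)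
      have "\<kappa> / \<epsilon> n * (\<integral>p. (\<phi> n p)\<^sup>2 \<partial>N) \<le> \<kappa> / \<epsilon> n * (C * (\<epsilon> n)\<^sup>2)"
        using \<kappa> e b(2)[of n] by (intro mult_left_mono) auto
      then show "\<kappa> / \<epsilon> n * (\<integral>p. (\<phi> n p)\<^sup>2 \<partial>N) \<le> \<epsilon> n * (C * \<kappa>)"
        using e by (simp add: power2_eq_square mult_ac)
    qed
    finally have "norm (\<integral>p. f p * \<phi> n p \<partial>N) \<le> (sqrt (a n) + C * \<kappa>) * \<epsilon> n"
      by (simp add: algebra_simps)
    then show ?thesis
      using e by (simp add: \<kappa>_def pos_divide_le_eq)
  qed
  moreover have "(\<lambda>n. sqrt (a n) + C * (sqrt (a n) + \<epsilon> n)) \<longlonglongrightarrow> 0"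
    using tendsto_add[OF tendsto_real_sqrt[OF a] tendsto_mult[OF tendsto_const[of C]
        tendsto_add[OF tendsto_real_sqrt[OF a] \<epsilon>(1)]]] by simp
  ultimately have "(\<lambda>n. (\<integral>p. f p * \<phi> n p \<partial>N) / \<epsilon> n) \<longlonglongrightarrow> 0"
    by (rule Lim_null_comparison[OF always_eventually[OF allI]])
  then show ?thesis
    unfolding N_def .
qed

text \<open>In the coordinates \<open>x + y\<close>, \<open>x - y\<close> the line is \<open>a s + b t = 0\<close>. The margin \<open>\<bar>a\<bar> + \<bar>b\<bar>\<close> keeps
  the unit bumps around the four corners of the rectangle away from it.\<close>

lemma jump_at_corner:
  fixes q1 q2 :: "plane \<Rightarrow> real"
  assumes "open \<Omega>" "v \<in> L2 \<Omega>" "f \<in> L2 \<Omega>" "weak_box \<Omega> v f" "0 < r" "ball c r \<subseteq> \<Omega>"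
    and "(n1, n2) \<noteq> (0, 0)"
    and v1: "AE p in lebesgue. p \<in> ball c r \<longrightarrow> n1 * (fst p - fst c) + n2 * (snd p - snd c) > 0 \<longrightarrow> v p = q1 p"
    and v2: "AE p in lebesgue. p \<in> ball c r \<longrightarrow> n1 * (fst p - fst c) + n2 * (snd p - snd c) < 0 \<longrightarrow> v p = q2 p"
    and q1: "continuous_on UNIV R1"
      "\<And>\<epsilon> h. q1 (c + \<epsilon> *\<^sub>R h) = q1 c + \<epsilon> * (a1 * fst h + b1 * snd h) + \<epsilon>\<^sup>2 * R1 (\<epsilon>, h)"
    and q2: "continuous_on UNIV R2"
      "\<And>\<epsilon> h. q2 (c + \<epsilon> *\<^sub>R h) = q2 c + \<epsilon> * (a2 * fst h + b2 * snd h) + \<epsilon>\<^sup>2 * R2 (\<epsilon>, h)"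
    and cont: "continuous_on UNIV q1" "continuous_on UNIV q2"
    and a: "a = n1 + n2" and b: "b = n1 - n2"
    and corners: "a * s1 + b * t1 > \<bar>a\<bar> + \<bar>b\<bar>" "a * s1 + b * t2 < - (\<bar>a\<bar> + \<bar>b\<bar>)"
      "a * s2 + b * t1 < - (\<bar>a\<bar> + \<bar>b\<bar>)" "a * s2 + b * t2 < - (\<bar>a\<bar> + \<bar>b\<bar>)"
  shows "q1 c = q2 c" and "(a1 - a2) * (s1 + t1) + (b1 - b2) * (s1 - t1) = 0"
proof -
  \<comment> \<open>Each bump reaches 1 beyond its centre, so \<open>F\<close>, \<open>G\<close> and
    their derivatives vanish beyond \<open>R\<close>.\<close>
  define R where "R = 1 + \<bar>s1\<bar> + \<bar>s2\<bar> + \<bar>t1\<bar> + \<bar>t2\<bar>"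
  have "R > 0"
    by (simp add: R_def)
  \<comment> \<open>The bound 1 serves the uniform remainder estimate; \<open>r / (3 * R)\<close>
    keeps the disc of radius \<open>2 * R * \<epsilon> n\<close> that carries the test function
    inside \<open>ball c r\<close>.\<close>
  define \<epsilon> where "\<epsilon> = (\<lambda>n. min 1 (r / (3 * R)) * inverse (real (Suc n)))"
  have \<epsilon>_pos: "0 < \<epsilon> n" for n
    using \<open>0 < r\<close> \<open>R > 0\<close> by (simp add: \<epsilon>_def)
  have \<epsilon>_le: "\<epsilon> n \<le> min 1 (r / (3 * R))" for n
    using \<open>0 < r\<close> \<open>R > 0\<close> by (simp only: \<epsilon>_def) (intro mult_left_le, auto simp: divide_simps)
  have \<epsilon>_lim: "\<epsilon> \<longlonglongrightarrow> 0"
    unfolding \<epsilon>_def by (rule tendsto_mult_right_zero[OF LIMSEQ_inverse_real_of_nat])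
  have ball: "cball c (2 * R * \<epsilon> n) \<subseteq> ball c r" for n
  proof -
    have "2 * R * \<epsilon> n \<le> 2 * R * (r / (3 * R))"
      using \<epsilon>_le[of n] \<open>R > 0\<close> by (intro mult_left_mono) auto
    also have "\<dots> < r"
      using \<open>R > 0\<close> \<open>0 < r\<close> by simp
    finally show ?thesis
      by (auto simp: dist_commute)
  qed
  define F G F' G' where "F = bump_step s1 s2" and "G = bump_step t1 t2"
    and "F' = (\<lambda>x. bump (x - s1) - bump (x - s2))" and "G' = (\<lambda>x. bump (x - t1) - bump (x - t2))"
  have F: "smooth F" "\<And>x. (F has_real_derivative F' x) (at x)" "\<And>x. \<bar>x\<bar> > R \<Longrightarrow> F x = 0"
    "smooth F'" "\<And>x. \<bar>x\<bar> > R \<Longrightarrow> F' x = 0"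
    unfolding F_def F'_def R_def
    by (auto intro!: smooth_bump_step bump_step_has_derivative bump_step_eq_0 smooth_diff smooth_bump_shift
        simp: bump_eq_0)
  have G: "smooth G" "\<And>x. (G has_real_derivative G' x) (at x)" "\<And>x. \<bar>x\<bar> > R \<Longrightarrow> G x = 0"
    "smooth G'" "\<And>x. \<bar>x\<bar> > R \<Longrightarrow> G' x = 0"
    unfolding G_def G'_def R_def
    by (auto intro!: smooth_bump_step bump_step_has_derivative bump_step_eq_0 smooth_diff smooth_bump_shift
        simp: bump_eq_0)
  have ct_borel: "char_tensor c e H K \<in> borel_measurable borel" if "smooth H" "smooth K" for e H K
    using Ck_function_char_tensor[OF that, of 0 c e] by (simp add: borel_measurable_continuous_onI)
  define \<sigma> where "\<sigma> = (\<lambda>p. n1 * (fst p - fst c) + n2 * (snd p - snd c))"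
  have \<sigma>_cont: "continuous_on UNIV \<sigma>"
    unfolding \<sigma>_def by (intro continuous_intros)
  \<comment> \<open>A Borel representative of \<open>v\<close> near \<open>c\<close>, as the change
    of variables requires; on the line itself, a null set, it takes the value of
    \<open>q2\<close>.\<close>
  define u where "u = (\<lambda>p. if \<sigma> p > 0 then q1 p else q2 p)"
  have [measurable]: "q1 \<in> borel_measurable borel" "q2 \<in> borel_measurable borel" "\<sigma> \<in> borel_measurable borel"
    using cont \<sigma>_cont by (auto intro: borel_measurable_continuous_onI)
  have u_borel [measurable]: "u \<in> borel_measurable borel"
    unfolding u_def by measurable
  have vu: "AE p in lebesgue. p \<in> ball c r \<longrightarrow> v p = u p"
  proof -
    have "negligible {p. (n1, n2) \<bullet> p = (n1, n2) \<bullet> c}"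
      using \<open>(n1, n2) \<noteq> (0, 0)\<close> by (intro negligible_hyperplane) (auto simp: zero_prod_def)
    then have "AE p in lebesgue. p \<notin> {p. (n1, n2) \<bullet> p = (n1, n2) \<bullet> c}"
      by (intro AE_not_in) (simp add: negligible_iff_null_sets)
    then have "AE p in lebesgue. \<sigma> p \<noteq> 0"
      by (rule AE_mp) (auto simp: \<sigma>_def inner_prod_def algebra_simps)
    with v1 v2 show ?thesis
      by eventually_elim (auto simp: u_def \<sigma>_def)
  qed
  define A where "A = (\<lambda>n q s t. \<integral>z. q (char_point c (\<epsilon> n) z) * bump2 s t z \<partial>lborel)"
  \<comment> \<open>The Jacobian \<open>(\<epsilon> n)\<^sup>2 / 2\<close> times
    \<open>4 / (\<epsilon> n)\<^sup>2\<close> from the wave operator leaves 2; expanding the product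
    of the two differences gives one average per corner.\<close>
  have main: "(\<integral>p. f p * char_tensor c (\<epsilon> n) F G p \<partial>lebesgue_on \<Omega>) =
      2 * (A n q1 s1 t1 - A n q2 s1 t2 - A n q2 s2 t1 + A n q2 s2 t2)" for n
  proof -
    have e: "0 < \<epsilon> n"
      by (rule \<epsilon>_pos)
    let ?\<phi> = "char_tensor c (\<epsilon> n) F G" and ?\<psi> = "char_tensor c (\<epsilon> n) F' G'"
    have "?\<phi> \<in> test_functions \<Omega>"
      using ball[of n] \<open>ball c r \<subseteq> \<Omega>\<close> by (intro char_tensor_test_function[OF F(1) G(1) F(3) G(3) e]) auto
    then have "(\<integral>p. f p * ?\<phi> p \<partial>lebesgue_on \<Omega>) = (\<integral>p. v p * box ?\<phi> p \<partial>lebesgue_on \<Omega>)"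
      using \<open>weak_box \<Omega> v f\<close> by (simp add: weak_box_def)
    also have "\<dots> = (\<integral>p. v p * (4 / (\<epsilon> n)\<^sup>2 * ?\<psi> p) \<partial>lebesgue_on \<Omega>)"
      by (simp add: box_char_tensor[OF F(1) G(1) F(2) G(2)])
    also have "\<dots> = (\<integral>p. indicator \<Omega> p *\<^sub>R (v p * (4 / (\<epsilon> n)\<^sup>2 * ?\<psi> p)) \<partial>lebesgue)"
      using \<open>open \<Omega>\<close> by (subst integral_restrict_space) auto
    also have "\<dots> = (\<integral>p. u p * (4 / (\<epsilon> n)\<^sup>2 * ?\<psi> p) \<partial>lebesgue)"
    proof (rule integral_cong_AE)
      have "v \<in> borel_measurable (lebesgue_on \<Omega>)"
        using \<open>v \<in> L2 \<Omega>\<close> by (simp add: L2_def)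
      moreover have "?\<psi> \<in> borel_measurable (lebesgue_on \<Omega>)"
        using ct_borel[OF F(4) G(4)] by (intro measurable_restrict_space1 measurable_completion) simp
      ultimately have "(\<lambda>p. v p * (4 / (\<epsilon> n)\<^sup>2 * ?\<psi> p)) \<in> borel_measurable (lebesgue_on \<Omega>)"
        by (intro borel_measurable_times borel_measurable_const)
      then show "(\<lambda>p. indicator \<Omega> p *\<^sub>R (v p * (4 / (\<epsilon> n)\<^sup>2 * ?\<psi> p))) \<in> borel_measurable lebesgue"
        using \<open>open \<Omega>\<close> by (subst (asm) borel_measurable_restrict_space_iff) auto
      show "(\<lambda>p. u p * (4 / (\<epsilon> n)\<^sup>2 * ?\<psi> p)) \<in> borel_measurable lebesgue"
        using ct_borel[OF F(4) G(4)] by (intro measurable_completion) simp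
      show "AE p in lebesgue. indicator \<Omega> p *\<^sub>R (v p * (4 / (\<epsilon> n)\<^sup>2 * ?\<psi> p)) = u p * (4 / (\<epsilon> n)\<^sup>2 * ?\<psi> p)"
        using vu
      proof eventually_elim
        case (elim p)
        have "?\<psi> p = 0" if "p \<notin> ball c r"
          using that ball[of n] by (intro char_tensor_support[OF F(5) G(5) e]) auto
        then show ?case
          using elim \<open>ball c r \<subseteq> \<Omega>\<close> by (cases "p \<in> ball c r") (auto simp: indicator_def)
      qed
    qed
    also have "\<dots> = (\<integral>p. u p * (4 / (\<epsilon> n)\<^sup>2 * ?\<psi> p) \<partial>lborel)"
      using ct_borel[OF F(4) G(4)] by (intro integral_completion) simp
    also have "\<dots> = (\<epsilon> n)\<^sup>2 / 2 * (\<integral>z. u (char_point c (\<epsilon> n) z) * (4 / (\<epsilon> n)\<^sup>2 * ?\<psi> (char_point c (\<epsilon> n) z)) \<partial>lborel)"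
      using ct_borel[OF F(4) G(4)] e by (intro integral_char_point) simp
    also have "(\<lambda>z. u (char_point c (\<epsilon> n) z) * (4 / (\<epsilon> n)\<^sup>2 * ?\<psi> (char_point c (\<epsilon> n) z))) =
        (\<lambda>z. 4 / (\<epsilon> n)\<^sup>2 * (u (char_point c (\<epsilon> n) z) * (F' (fst z) * G' (snd z))))"
      using e by (intro ext) (simp add: char_tensor_def char_point_def field_simps)
    also have "(\<epsilon> n)\<^sup>2 / 2 * (\<integral>z. 4 / (\<epsilon> n)\<^sup>2 * (u (char_point c (\<epsilon> n) z) * (F' (fst z) * G' (snd z))) \<partial>lborel)
        = 2 * (\<integral>z. u (char_point c (\<epsilon> n) z) * (F' (fst z) * G' (snd z)) \<partial>lborel)"
      using e by simp
    also have "(\<lambda>z. u (char_point c (\<epsilon> n) z) * (F' (fst z) * G' (snd z))) =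
        (\<lambda>z. q1 (char_point c (\<epsilon> n) z) * bump2 s1 t1 z - q2 (char_point c (\<epsilon> n) z) * bump2 s1 t2 z
          - q2 (char_point c (\<epsilon> n) z) * bump2 s2 t1 z + q2 (char_point c (\<epsilon> n) z) * bump2 s2 t2 z)"
    proof
      fix z
      have \<sigma>z: "\<sigma> (char_point c (\<epsilon> n) z) = \<epsilon> n / 2 * (a * fst z + b * snd z)"
        by (simp add: \<sigma>_def char_point_def a b field_simps)
      have near: "\<bar>(a * fst z + b * snd z) - (a * s + b * t)\<bar> \<le> \<bar>a\<bar> + \<bar>b\<bar>" if "bump2 s t z \<noteq> 0" for s t
      proof -
        have "\<bar>(a * fst z + b * snd z) - (a * s + b * t)\<bar> = \<bar>a * (fst z - s) + b * (snd z - t)\<bar>"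
          by (simp add: algebra_simps)
        also have "\<dots> \<le> \<bar>a\<bar> * \<bar>fst z - s\<bar> + \<bar>b\<bar> * \<bar>snd z - t\<bar>"
          by (simp add: abs_mult[symmetric] abs_triangle_ineq)
        also have "\<dots> \<le> \<bar>a\<bar> * 1 + \<bar>b\<bar> * 1"
          using bump2_nonzeroD[OF that] by (intro add_mono mult_left_mono) auto
        finally show ?thesis by simp
      qed
      have plus: "u (char_point c (\<epsilon> n) z) * bump2 s t z = q1 (char_point c (\<epsilon> n) z) * bump2 s t z"
        if "a * s + b * t > \<bar>a\<bar> + \<bar>b\<bar>" for s t
      proof (cases "bump2 s t z = 0")
        case False
        then have "a * fst z + b * snd z > 0"
          using near[of s t] that by linarith
        then show ?thesis
          using e by (simp add: u_def \<sigma>z)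
      qed simp
      have minus: "u (char_point c (\<epsilon> n) z) * bump2 s t z = q2 (char_point c (\<epsilon> n) z) * bump2 s t z"
        if "a * s + b * t < - (\<bar>a\<bar> + \<bar>b\<bar>)" for s t
      proof (cases "bump2 s t z = 0")
        case False
        then have "a * fst z + b * snd z < 0"
          using near[of s t] that by linarith
        then have "\<not> \<sigma> (char_point c (\<epsilon> n) z) > 0"
          using e by (simp add: \<sigma>z zero_less_mult_iff)
        then show ?thesis
          by (simp add: u_def)
      qed simp
      have "u (char_point c (\<epsilon> n) z) * (F' (fst z) * G' (snd z)) =
          u (char_point c (\<epsilon> n) z) * bump2 s1 t1 z - u (char_point c (\<epsilon> n) z) * bump2 s1 t2 z
          - u (char_point c (\<epsilon> n) z) * bump2 s2 t1 z + u (char_point c (\<epsilon> n) z) * bump2 s2 t2 z"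
        by (simp add: F'_def G'_def bump2_def algebra_simps)
      then show "u (char_point c (\<epsilon> n) z) * (F' (fst z) * G' (snd z)) =
          q1 (char_point c (\<epsilon> n) z) * bump2 s1 t1 z - q2 (char_point c (\<epsilon> n) z) * bump2 s1 t2 z
          - q2 (char_point c (\<epsilon> n) z) * bump2 s2 t1 z + q2 (char_point c (\<epsilon> n) z) * bump2 s2 t2 z"
        using plus[OF corners(1)] minus[OF corners(2)] minus[OF corners(3)] minus[OF corners(4)] by simp
    qed
    also have "(\<integral>z. q1 (char_point c (\<epsilon> n) z) * bump2 s1 t1 z - q2 (char_point c (\<epsilon> n) z) * bump2 s1 t2 z
          - q2 (char_point c (\<epsilon> n) z) * bump2 s2 t1 z + q2 (char_point c (\<epsilon> n) z) * bump2 s2 t2 z \<partial>lborel)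
        = A n q1 s1 t1 - A n q2 s1 t2 - A n q2 s2 t1 + A n q2 s2 t2"
    proof -
      have "continuous_on UNIV (\<lambda>z. q (char_point c (\<epsilon> n) z))" if "continuous_on UNIV q" for q :: "plane \<Rightarrow> real"
        unfolding char_point_def by (intro continuous_on_compose2[OF that] continuous_intros) auto
      then have "integrable lborel (\<lambda>z. q (char_point c (\<epsilon> n) z) * bump2 s t z)"
        if "continuous_on UNIV q" for q :: "plane \<Rightarrow> real" and s t
        using that by (intro integrable_continuous_bump2)
      then show ?thesis
        using cont by (simp add: A_def)
    qed
    finally show ?thesis .
  qed
  define I where "I = bump_mass\<^sup>2"
  have "I \<noteq> 0"
    using bump_mass_pos by (simp add: I_def)
  define E1 where "E1 = (\<lambda>n s t. (A n q1 s t - (q1 c + \<epsilon> n * (a1 * (s + t) / 2 + b1 * (s - t) / 2)) * I) / \<epsilon> n)"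
  define E2 where "E2 = (\<lambda>n s t. (A n q2 s t - (q2 c + \<epsilon> n * (a2 * (s + t) / 2 + b2 * (s - t) / 2)) * I) / \<epsilon> n)"
  have E: "(\<lambda>n. E1 n s t) \<longlonglongrightarrow> 0" "(\<lambda>n. E2 n s t) \<longlonglongrightarrow> 0" for s t
    unfolding E1_def E2_def A_def I_def
    using bump2_average_taylor[OF q1 \<epsilon>_lim \<epsilon>_pos] bump2_average_taylor[OF q2 \<epsilon>_lim \<epsilon>_pos] \<epsilon>_le by auto
  define T where "T = (\<lambda>n. (\<integral>p. f p * char_tensor c (\<epsilon> n) F G p \<partial>lebesgue_on \<Omega>) / \<epsilon> n)"
  have "T \<longlonglongrightarrow> 0"
  proof -
    have "compact (F ` cball 0 R)" "compact (G ` cball 0 R)"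
      using F(1) G(1) by (auto intro!: compact_continuous_image smooth_continuous)
    then obtain MF MG where M: "\<And>x. x \<in> cball 0 R \<Longrightarrow> \<bar>F x\<bar> \<le> MF" "\<And>x. x \<in> cball 0 R \<Longrightarrow> \<bar>G x\<bar> \<le> MG"
      using compact_imp_bounded[of "F ` cball 0 R"] compact_imp_bounded[of "G ` cball 0 R"]
      unfolding bounded_iff by fastforce
    have MF: "\<bar>F x\<bar> \<le> \<bar>MF\<bar>" and MG: "\<bar>G x\<bar> \<le> \<bar>MG\<bar>" for x
      using M(1)[of x] M(2)[of x] F(3)[of x] G(3)[of x] abs_ge_self[of MF] abs_ge_self[of MG]
      by (cases "\<bar>x\<bar> > R"; simp)+
    show ?thesis
      unfolding T_def
    proof (rule L2_pairing_small_support[OF \<open>open \<Omega>\<close> \<open>f \<in> L2 \<Omega>\<close> \<epsilon>_lim \<epsilon>_pos, where \<rho> = "2 * R" and c = c])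
      show "\<bar>char_tensor c (\<epsilon> n) F G p\<bar> \<le> \<bar>MF\<bar> * \<bar>MG\<bar>" for n p
        unfolding char_tensor_def abs_mult by (intro mult_mono MF MG) auto
      show "char_tensor c (\<epsilon> n) F G p = 0" if "p \<notin> cball c (2 * R * \<epsilon> n)" for n p
        using char_tensor_support[OF F(3) G(3) \<epsilon>_pos that] by simp
    qed (use \<open>R > 0\<close> F(1) G(1) ct_borel in auto)
  qed
  \<comment> \<open>The alternating sum of an affine function over a rectangle vanishes, so the
    affine parts of \<open>q2\<close> at three corners amount to its affine part at
    \<open>(s1, t1)\<close>. What remains is the jump of the affine parts at that corner, and
    \<open>d / \<epsilon> n + L\<close> is this jump divided by \<open>\<epsilon> n\<close>.\<close>
  define d L where "d = q1 c - q2 c" and "L = ((a1 - a2) * (s1 + t1) + (b1 - b2) * (s1 - t1)) / 2"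
  have "E1 n s1 t1 - E2 n s1 t2 - E2 n s2 t1 + E2 n s2 t2 - T n / 2 = - ((d / \<epsilon> n + L) * I)" for n
  proof -
    have "\<epsilon> n \<noteq> 0"
      using \<epsilon>_pos[of n] by simp
    then show ?thesis
      unfolding E1_def E2_def T_def main d_def L_def by (simp add: field_simps)
  qed
  moreover have "(\<lambda>n. E1 n s1 t1 - E2 n s1 t2 - E2 n s2 t1 + E2 n s2 t2 - T n / 2) \<longlonglongrightarrow> 0 - 0 - 0 + 0 - 0 / 2"
    by (intro tendsto_intros E \<open>T \<longlonglongrightarrow> 0\<close>) auto
  ultimately have "(\<lambda>n. - ((d / \<epsilon> n + L) * I)) \<longlonglongrightarrow> 0"
    by simp
  then have "(\<lambda>n. - ((d / \<epsilon> n + L) * I) / (- I)) \<longlonglongrightarrow> 0 / (- I)"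
    using \<open>I \<noteq> 0\<close> by (intro tendsto_divide tendsto_const) auto
  then have lim: "(\<lambda>n. d / \<epsilon> n + L) \<longlonglongrightarrow> 0"
    using \<open>I \<noteq> 0\<close> by (simp add: add.commute)
  \<comment> \<open>Multiplication by \<open>\<epsilon> n\<close> isolates the jump of the value;
    once that is zero, the limit itself says that \<open>L\<close> vanishes.\<close>
  have "(\<lambda>n. \<epsilon> n * (d / \<epsilon> n + L)) \<longlonglongrightarrow> 0 * 0"
    by (intro tendsto_mult \<epsilon>_lim lim)
  moreover have "(\<lambda>n. \<epsilon> n * (d / \<epsilon> n + L)) = (\<lambda>n. d + \<epsilon> n * L)"
    using \<epsilon>_pos by (auto simp: fun_eq_iff distrib_left less_imp_neq[symmetric])
  moreover have "(\<lambda>n. d + \<epsilon> n * L) \<longlonglongrightarrow> d + 0 * L"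
    by (intro tendsto_intros \<epsilon>_lim)
  ultimately have "d = 0"
    using LIMSEQ_unique by force
  then show "q1 c = q2 c"
    by (simp add: d_def)
  have "L = 0"
    using lim \<open>d = 0\<close> by (simp add: LIMSEQ_const_iff)
  then show "(a1 - a2) * (s1 + t1) + (b1 - b2) * (s1 - t1) = 0"
    by (simp add: L_def)
qed

text \<open>The characteristic coordinates enter the equation of the line with the coefficients
  \<open>a\<close> and \<open>b\<close>, whose product is \<open>n1\<^sup>2 - n2\<^sup>2\<close>. As
  both are nonzero, moving far enough along either coordinate crosses the line, which makes room for
  the required rectangles. Two of them with different proportions give independent equations for the
  jump of the gradient.\<close>

lemma jump_conditions:
  fixes q1 q2 :: "plane \<Rightarrow> real"
  assumes "open \<Omega>" "v \<in> L2 \<Omega>" "f \<in> L2 \<Omega>" "weak_box \<Omega> v f" "0 < r" "ball c r \<subseteq> \<Omega>"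
    and "n1\<^sup>2 \<noteq> n2\<^sup>2"
    and v1: "AE p in lebesgue. p \<in> ball c r \<longrightarrow> n1 * (fst p - fst c) + n2 * (snd p - snd c) > 0 \<longrightarrow> v p = q1 p"
    and v2: "AE p in lebesgue. p \<in> ball c r \<longrightarrow> n1 * (fst p - fst c) + n2 * (snd p - snd c) < 0 \<longrightarrow> v p = q2 p"
    and q1: "continuous_on UNIV R1"
      "\<And>\<epsilon> h. q1 (c + \<epsilon> *\<^sub>R h) = q1 c + \<epsilon> * (a1 * fst h + b1 * snd h) + \<epsilon>\<^sup>2 * R1 (\<epsilon>, h)"
    and q2: "continuous_on UNIV R2"
      "\<And>\<epsilon> h. q2 (c + \<epsilon> *\<^sub>R h) = q2 c + \<epsilon> * (a2 * fst h + b2 * snd h) + \<epsilon>\<^sup>2 * R2 (\<epsilon>, h)"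
    and cont: "continuous_on UNIV q1" "continuous_on UNIV q2"
  shows "q1 c = q2 c \<and> a1 = a2 \<and> b1 = b2"
proof -
  define a b K where "a = n1 + n2" and "b = n1 - n2" and "K = \<bar>a\<bar> + \<bar>b\<bar> + 1"
  have "a * b = n1\<^sup>2 - n2\<^sup>2"
    by (simp add: a_def b_def power2_eq_square algebra_simps)
  then have ab: "a \<noteq> 0" "b \<noteq> 0"
    using \<open>n1\<^sup>2 \<noteq> n2\<^sup>2\<close> by auto
  have n: "(n1, n2) \<noteq> (0, 0)"
    using \<open>n1\<^sup>2 \<noteq> n2\<^sup>2\<close> by auto
  \<comment> \<open>Measured by \<open>a * s + b * t\<close> in units of \<open>K\<close>, the first
    corner gets 1 from each coordinate, or 2 from the second one in the other rectangle. The value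
    -3 outweighs either, so all other corners are at \<open>- K\<close> or below, beyond the margin
    \<open>\<bar>a\<bar> + \<bar>b\<bar>\<close>.\<close>
  note J = jump_at_corner[OF assms(1-6) n v1 v2 q1 q2 cont a_def b_def, where ?s2.0 = "- 3 * K / a" and ?t2.0 = "- 3 * K / b"]
  have 1: "q1 c = q2 c" "(a1 - a2) * (K / a + K / b) + (b1 - b2) * (K / a - K / b) = 0"
    using J[of "K / a" "K / b"] ab by (auto simp: K_def)
  have 2: "(a1 - a2) * (K / a + 2 * (K / b)) + (b1 - b2) * (K / a - 2 * (K / b)) = 0"
    using J(2)[of "K / a" "2 * (K / b)"] ab by (auto simp: K_def)
  define x y where "x = K / a" and "y = K / b"
  have "x \<noteq> 0" "y \<noteq> 0"
    using ab by (auto simp: x_def y_def K_def)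
  have e1: "((a1 - a2) + (b1 - b2)) * x + ((a1 - a2) - (b1 - b2)) * y = 0"
    and e2: "((a1 - a2) + (b1 - b2)) * x + 2 * (((a1 - a2) - (b1 - b2)) * y) = 0"
    using 1(2) 2 unfolding x_def[symmetric] y_def[symmetric] by (simp_all add: algebra_simps)
  then have "((a1 - a2) - (b1 - b2)) * y = 0" "((a1 - a2) + (b1 - b2)) * x = 0"
    by linarith+
  with \<open>x \<noteq> 0\<close> \<open>y \<noteq> 0\<close> 1(1) show ?thesis
    by auto
qed

section \<open>Local structure of the triangulation\<close>

lemma is_triangleD:
  assumes "is_triangle \<Omega> T"
  shows "compact (body T)" "finite (vertices T)" "finite (sides T)"
    and "frontier (body T) = \<Union>(sides T)" "vertices T \<subseteq> frontier (body T)"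
    and "\<And>e. e \<in> sides T \<Longrightarrow>
      e \<subseteq> frontier \<Omega> \<or> (\<exists>a\<in>vertices T. \<exists>b\<in>vertices T. a \<noteq> b \<and> e = closed_segment a b)"
    and "\<And>e. e \<in> sides T \<Longrightarrow> closed e"
    and "\<And>e e' x. e \<in> sides T \<Longrightarrow> e' \<in> sides T \<Longrightarrow> e \<noteq> e' \<Longrightarrow> x \<in> e \<Longrightarrow> x \<in> e' \<Longrightarrow> x \<in> vertices T"
proof -
  obtain a b c \<alpha> \<beta> \<gamma> where d: "distinct [a, b, c]"
    and s: "side_between \<Omega> a b \<alpha>" "side_between \<Omega> b c \<beta>" "side_between \<Omega> c a \<gamma>"
    and i: "\<alpha> \<inter> \<beta> = {b}" "\<beta> \<inter> \<gamma> = {c}" "\<gamma> \<inter> \<alpha> = {a}"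
    and f: "frontier (body T) = \<alpha> \<union> \<beta> \<union> \<gamma>" and v: "vertices T = {a, b, c}" and sd: "sides T = {\<alpha>, \<beta>, \<gamma>}"
    using assms unfolding is_triangle_def by (elim conjE exE) (rule that; assumption)
  show "compact (body T)"
    using assms by (simp add: is_triangle_def)
  show "finite (vertices T)" "finite (sides T)" "frontier (body T) = \<Union>(sides T)"
    using v sd f by auto
  show "vertices T \<subseteq> frontier (body T)"
    using v f i by auto
  have seg: "e \<subseteq> frontier \<Omega> \<or> e = closed_segment p q" and cl: "closed e" if "side_between \<Omega> p q e" for p q e
    using that unfolding side_between_def smooth_arc_def
    by (auto intro: compact_imp_closed compact_path_image arc_imp_path)
  show "e \<subseteq> frontier \<Omega> \<or> (\<exists>a\<in>vertices T. \<exists>b\<in>vertices T. a \<noteq> b \<and> e = closed_segment a b)"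
    if "e \<in> sides T" for e
  proof -
    have "a \<noteq> b" "b \<noteq> c" "c \<noteq> a"
      using d by auto
    then have "\<exists>p\<in>vertices T. \<exists>q\<in>vertices T. p \<noteq> q \<and> side_between \<Omega> p q e"
      using that s unfolding v sd by blast
    then show ?thesis
      using seg by blast
  qed
  show "closed e" if "e \<in> sides T" for e
    using that cl[OF s(1)] cl[OF s(2)] cl[OF s(3)] unfolding sd by auto
  show "x \<in> vertices T" if "e \<in> sides T" "e' \<in> sides T" "e \<noteq> e'" "x \<in> e" "x \<in> e'" for e e' x
  proof -
    have "x \<in> \<alpha> \<Longrightarrow> x \<in> \<beta> \<Longrightarrow> x = b" "x \<in> \<beta> \<Longrightarrow> x \<in> \<gamma> \<Longrightarrow> x = c" "x \<in> \<gamma> \<Longrightarrow> x \<in> \<alpha> \<Longrightarrow> x = a"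
      using i by blast+
    with that show ?thesis
      unfolding sd v by auto
  qed
qed

text \<open>The tangent turned by a right angle is a normal, and \<open>bar\<close> maps it to
  \<open>(- snd \<tau>, - fst \<tau>)\<close>, which is \<tau> up to sign when the components of
  \<tau> agree up to sign. The contrapositive turns the absence of type I edges into
  \<open>n1\<^sup>2 \<noteq> n2\<^sup>2\<close>.\<close>

lemma type_I_closed_segment:
  assumes "a \<noteq> b" "(fst (b - a))\<^sup>2 = (snd (b - a))\<^sup>2"
  shows "type_I (closed_segment a b)"
proof -
  define \<tau> where "\<tau> = sgn (b - a)"
  define n where "n = (- snd \<tau>, fst \<tau>)"
  have t: "unit_tangent (closed_segment a b) \<tau>"
    using \<open>a \<noteq> b\<close> unfolding unit_tangent_def \<tau>_def by blast
  have "norm \<tau> = 1"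
    using \<open>a \<noteq> b\<close> by (simp add: \<tau>_def norm_sgn)
  then have "norm n = 1"
    by (simp add: n_def norm_prod_def add.commute)
  moreover have "n \<bullet> \<tau> = 0"
    by (simp add: n_def inner_prod_def)
  ultimately have "unit_normal (closed_segment a b) n"
    using t unfolding unit_normal_def by blast
  moreover have "fst \<tau> = snd \<tau> \<or> fst \<tau> = - snd \<tau>"
  proof -
    have "fst \<tau> = fst (b - a) / norm (b - a)" "snd \<tau> = snd (b - a) / norm (b - a)"
      unfolding \<tau>_def sgn_div_norm fst_scaleR snd_scaleR by (simp_all add: divide_inverse mult.commute)
    moreover have "fst (b - a) = snd (b - a) \<or> fst (b - a) = - snd (b - a)"
      using assms(2) by (simp only: power2_eq_iff)
    ultimately show ?thesis
      by (metis minus_divide_left)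
  qed
  then have "bar n = \<tau> \<or> bar n = - \<tau>"
    by (auto simp: bar_def n_def prod_eq_iff)
  ultimately show ?thesis
    using t unfolding type_I_def by blast
qed

text \<open>Connectedness keeps a half ball within one triangle, openness places it in the interior,
  and \<open>c\<close> in the closure brings \<open>c\<close> into the closed body.\<close>

lemma half_ball:
  fixes c :: plane
  assumes "0 < r" "(n1, n2) \<noteq> (0, 0)"
  defines "H \<equiv> {p \<in> ball c r. n1 * (fst p - fst c) + n2 * (snd p - snd c) > 0}"
  shows "open H" "connected H" "H \<noteq> {}" "c \<in> closure H"
proof -
  have H: "H = ball c r \<inter> {p. (n1, n2) \<bullet> p > (n1, n2) \<bullet> c}"
    by (auto simp: H_def inner_prod_def algebra_simps)
  show "open H"
    unfolding H by (intro open_Int open_ball open_halfspace_gt)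
  show "connected H"
    unfolding H by (intro convex_connected convex_Int convex_ball convex_halfspace_gt)
  define w where "w = (n1, n2)"
  have w: "w \<noteq> 0"
    using assms(2) by (simp add: w_def zero_prod_def)
  have norm_w: "norm ((t / norm w) *\<^sub>R w) = t" if "0 < t" for t
    using that w by simp
  have mem: "c + (t / norm w) *\<^sub>R w \<in> H" if "0 < t" "t < r" for t
  proof -
    have "(t / norm w) * (w \<bullet> w) > 0"
      using that w by simp
    moreover have "dist c (c + (t / norm w) *\<^sub>R w) = t"
      using norm_w[OF that(1)] by (simp add: dist_norm)
    ultimately show ?thesis
      using that by (simp add: H w_def[symmetric] inner_add_right)
  qed
  show "H \<noteq> {}"
    using mem[of "r / 2"] \<open>0 < r\<close> by auto
  show "c \<in> closure H"
    unfolding closure_approachable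
  proof safe
    fix e :: real assume "0 < e"
    define t where "t = min (r / 2) (e / 2)"
    have t: "0 < t" "t < r" "t < e"
      using \<open>0 < e\<close> \<open>0 < r\<close> by (auto simp: t_def)
    have "dist (c + (t / norm w) *\<^sub>R w) c = t"
      using norm_w[OF t(1)] by (simp add: dist_norm)
    then show "\<exists>y\<in>H. dist y c < e"
      using mem[OF t(1,2)] t(3) by (intro bexI[of _ "c + (t / norm w) *\<^sub>R w"]) simp_all
  qed
qed

lemma open_not_subset_line:
  fixes U :: "plane set"
  assumes "open U" "U \<noteq> {}" "(n1, n2) \<noteq> (0, 0)"
  shows "\<exists>p\<in>U. n1 * (fst p - fst c) + n2 * (snd p - snd c) \<noteq> 0"
proof (rule ccontr)
  assume "\<not> ?thesis"
  then have "U \<subseteq> {p. (n1, n2) \<bullet> p = (n1, n2) \<bullet> c}"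
    by (auto simp: inner_prod_def algebra_simps)
  then have "negligible U"
    using negligible_hyperplane[of "(n1, n2)"] assms(3) negligible_subset by (metis zero_prod_def)
  with assms show False
    using open_not_negligible by blast
qed

section \<open>Nodes, common sides and disjoint interiors of a mesh\<close>

locale mesh =
  fixes \<Omega> :: "plane set" and \<T> :: "triangle set"
  assumes open_domain: "open \<Omega>" and bounded_domain: "bounded \<Omega>"
    and triangulation: "triangulation_of \<Omega> \<T>"
    and no_type_I: "\<forall>e\<in>interior_edges \<T>. \<not> type_I e"
begin

definition nodes :: "plane set" where
  "nodes = (\<Union>T\<in>\<T>. vertices T)"

lemma finite_mesh: "finite \<T>"
  using triangulation by (simp add: triangulation_of_def)

lemma mesh_triangle: "T \<in> \<T> \<Longrightarrow> is_triangle \<Omega> T"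
  using triangulation by (simp add: triangulation_of_def)

lemma finite_nodes: "finite nodes"
  unfolding nodes_def using finite_mesh is_triangleD(2)[OF mesh_triangle] by auto

lemma closed_body: "T \<in> \<T> \<Longrightarrow> closed (body T)"
  using is_triangleD(1)[OF mesh_triangle] compact_imp_closed by auto

lemma domain_covered:
  assumes "x \<in> \<Omega>" shows "\<exists>T\<in>\<T>. x \<in> body T"
proof -
  have "(\<Union>T\<in>\<T>. body T) = closure \<Omega>"
    using triangulation by (simp add: triangulation_of_def)
  then show ?thesis
    using assms closure_subset[of \<Omega>] by blast
qed

lemma conforming:
  assumes "T \<in> \<T>" "T' \<in> \<T>" "T \<noteq> T'" "x \<in> body T" "x \<in> body T'" "x \<notin> nodes"
  shows "\<exists>e. e \<in> sides T \<and> e \<in> sides T' \<and> x \<in> e"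
proof -
  have "body T \<inter> body T' = \<Union>(sides T \<inter> sides T') \<union> (vertices T \<inter> vertices T')"
    using assms(1-3) triangulation by (simp add: triangulation_of_def)
  then show ?thesis
    using assms by (auto simp: nodes_def)
qed

text \<open>Conformity confines the intersection of the bodies to sides and vertices, hence to the
  frontier of \<open>T\<close>.\<close>

lemma interiors_disjoint:
  assumes "T \<in> \<T>" "T' \<in> \<T>" "T \<noteq> T'"
  shows "interior (body T) \<inter> interior (body T') = {}"
proof -
  have "body T \<inter> body T' = \<Union>(sides T \<inter> sides T') \<union> (vertices T \<inter> vertices T')"
    using assms triangulation by (simp add: triangulation_of_def)
  then have "body T \<inter> body T' \<subseteq> frontier (body T)"
    using is_triangleD(4,5)[OF mesh_triangle[OF assms(1)]] by auto
  then show ?thesis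
    using interior_subset by (fastforce simp: frontier_def)
qed

lemma boundary_point_on_segment:
  assumes "x \<in> \<Omega>" "T \<in> \<T>" "x \<in> body T" "x \<notin> interior (body T)"
  obtains a b where "a \<in> vertices T" "b \<in> vertices T" "a \<noteq> b" "closed_segment a b \<in> sides T" "x \<in> closed_segment a b"
proof -
  have "x \<in> frontier (body T)"
    using assms(3,4) closure_subset by (auto simp: frontier_def)
  then obtain e where e: "e \<in> sides T" "x \<in> e"
    using is_triangleD(4)[OF mesh_triangle[OF assms(2)]] by auto
  moreover have "x \<notin> frontier \<Omega>"
    using \<open>x \<in> \<Omega>\<close> open_domain by (simp add: frontier_def interior_open)
  ultimately show ?thesis
    using is_triangleD(6)[OF mesh_triangle[OF assms(2)], of e] that by blast
qed

text \<open>Points in the interior of a triangle are covered too: there the line is arbitrary and \<open>T1 = T2\<close>.\<close>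

definition local_split :: "plane \<Rightarrow> real \<Rightarrow> real \<Rightarrow> real \<Rightarrow> triangle \<Rightarrow> triangle \<Rightarrow> bool" where
  "local_split c r n1 n2 T1 T2 \<longleftrightarrow>
     0 < r \<and> ball c r \<subseteq> \<Omega> - nodes \<and> n1\<^sup>2 \<noteq> n2\<^sup>2 \<and> T1 \<in> \<T> \<and> T2 \<in> \<T> \<and>
     {p \<in> ball c r. n1 * (fst p - fst c) + n2 * (snd p - snd c) > 0} \<subseteq> body T1 \<and>
     {p \<in> ball c r. n1 * (fst p - fst c) + n2 * (snd p - snd c) < 0} \<subseteq> body T2"

text \<open>A triangle is given through its frontier, without convexity. A connected set that meets
  a body but not its frontier cannot leave it, and this suffices to locate a half ball.\<close>

lemma half_ball_subset_body:
  assumes "connected H" "H \<noteq> {}" "H \<subseteq> \<Omega>" "\<And>T. T \<in> \<T> \<Longrightarrow> H \<inter> frontier (body T) = {}"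
  shows "\<exists>T\<in>\<T>. H \<subseteq> body T"
proof -
  obtain p where "p \<in> H"
    using assms(2) by auto
  then obtain T where T: "T \<in> \<T>" "p \<in> body T"
    using assms(3) domain_covered by blast
  then have "H \<inter> body T \<noteq> {}"
    using \<open>p \<in> H\<close> by auto
  then have "H - body T = {}"
    using connected_Int_frontier[OF assms(1)] assms(4)[OF T(1)] by blast
  with T(1) show ?thesis
    by auto
qed

text \<open>Two sides of one triangle meet only in its vertices, so the common side through
  \<open>c\<close> that conformity provides can only be \<open>e\<close>.\<close>

lemma edge_shared:
  assumes "c \<notin> nodes" "T \<in> \<T>" "e \<in> sides T" "c \<in> e" "T' \<in> \<T>" "c \<in> body T'"
  shows "e \<in> sides T'"
proof (cases "T' = T")
  case False
  have "c \<in> body T"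
    using assms(2-4) is_triangleD(4)[OF mesh_triangle] frontier_subset_closed[OF closed_body] by blast
  then obtain e' where "e' \<in> sides T" "e' \<in> sides T'" "c \<in> e'"
    using conforming[of T T' c] False assms by auto
  moreover have "e' = e"
    using is_triangleD(8)[OF mesh_triangle[OF assms(2)]] calculation assms by (metis nodes_def UN_I)
  ultimately show ?thesis
    by simp
qed (use assms in simp)

text \<open>In a ball that avoids the triangles and sides missing \<open>c\<close>, all frontiers
  lie on a single edge \<open>e\<close>. Each open half ball therefore falls into one triangle; both
  triangles contain \<open>c\<close>, so both have \<open>e\<close> as a side. They are distinct,
  which makes \<open>e\<close> an interior edge and its normal noncharacteristic.\<close>

lemma local_split_exists:
  assumes "c \<in> \<Omega>" "c \<notin> nodes"
  shows "\<exists>r n1 n2 T1 T2. local_split c r n1 n2 T1 T2"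
proof -
  have op: "open (\<Omega> - nodes)"
    using open_domain finite_nodes by (simp add: open_Diff finite_imp_closed)
  consider T where "T \<in> \<T>" "c \<in> interior (body T)" | "\<And>T. T \<in> \<T> \<Longrightarrow> c \<notin> interior (body T)"
    by blast
  then show ?thesis
  proof cases
    case 1
    have "open ((\<Omega> - nodes) \<inter> interior (body T))"
      using op by auto
    then obtain r where "0 < r" "ball c r \<subseteq> (\<Omega> - nodes) \<inter> interior (body T)"
      using assms 1 by (metis DiffI IntI open_contains_ball)
    then have "local_split c r 1 0 T T"
      using 1 interior_subset by (fastforce simp: local_split_def)
    then show ?thesis
      by blast
  next
    case 2
    obtain T where T: "T \<in> \<T>" "c \<in> body T"
      using domain_covered assms by blast
    then obtain a b where ab: "a \<noteq> b" "closed_segment a b \<in> sides T" "c \<in> closed_segment a b"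
      using boundary_point_on_segment 2 assms by metis
    define e where "e = closed_segment a b"
    \<comment> \<open>A finite union of closed sets that miss \<open>c\<close>, so a small ball
      around \<open>c\<close> avoids it.\<close>
    define K where "K = \<Union>{body T |T. T \<in> \<T> \<and> c \<notin> body T} \<union> \<Union>{s. \<exists>T\<in>\<T>. s \<in> sides T \<and> c \<notin> s}"
    have "closed K"
    proof -
      have "finite {body T |T. T \<in> \<T> \<and> c \<notin> body T}"
        using finite_mesh by simp
      moreover have "finite {s. \<exists>T\<in>\<T>. s \<in> sides T \<and> c \<notin> s}"
        by (rule finite_subset[of _ "\<Union>(sides ` \<T>)"]) (use finite_mesh is_triangleD(3)[OF mesh_triangle] in auto)
      ultimately show ?thesis
        unfolding K_def using closed_body is_triangleD(7)[OF mesh_triangle]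
        by (intro closed_Un closed_Union) auto
    qed
    moreover have "c \<notin> K"
      by (auto simp: K_def)
    ultimately have "open ((\<Omega> - nodes) - K)" "c \<in> (\<Omega> - nodes) - K"
      using op assms by auto
    then obtain r where r: "0 < r" "ball c r \<subseteq> (\<Omega> - nodes) - K"
      by (meson open_contains_ball)
    have front: "p \<in> e" if p: "p \<in> ball c r" "p \<in> frontier (body T')" and T': "T' \<in> \<T>" for p T'
    proof -
      have "p \<notin> K"
        using r p(1) by auto
      moreover have "p \<in> body T'"
        using p(2) frontier_subset_closed[OF closed_body[OF T']] by blast
      ultimately have "c \<in> body T'"
        using T' by (auto simp: K_def)
      then have "e \<in> sides T'"
        using edge_shared[OF assms(2) T(1) ab(2,3) T'] by (simp add: e_def)
      obtain s where s: "s \<in> sides T'" "p \<in> s"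
        using p(2) is_triangleD(4)[OF mesh_triangle[OF T']] by blast
      with \<open>p \<notin> K\<close> have "c \<in> s"
        using T' by (auto simp: K_def)
      then have "s = e"
        using is_triangleD(8)[OF mesh_triangle[OF T'] s(1) \<open>e \<in> sides T'\<close>, of c] ab(3) assms(2) T'
        by (auto simp: e_def nodes_def)
      with s show ?thesis by simp
    qed
    \<comment> \<open>The direction of the edge turned by a right angle; its length does not
      matter.\<close>
    define n1 n2 where "n1 = - snd (b - a)" and "n2 = fst (b - a)"
    have n0: "(n1, n2) \<noteq> (0, 0)"
      using ab(1) by (auto simp: n1_def n2_def prod_eq_iff)
    have line: "n1 * (fst p - fst c) + n2 * (snd p - snd c) = 0" if "p \<in> e" for p
    proof -
      have *: "\<exists>u. q = (1 - u) *\<^sub>R a + u *\<^sub>R b" if "q \<in> e" for q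
        using that by (auto simp: e_def in_segment)
      obtain u where u: "p = (1 - u) *\<^sub>R a + u *\<^sub>R b"
        using *[of p] \<open>p \<in> e\<close> by blast
      obtain t where t: "c = (1 - t) *\<^sub>R a + t *\<^sub>R b"
        using *[of c] ab(3) by (auto simp: e_def)
      show ?thesis
        unfolding u t n1_def n2_def by (simp add: algebra_simps)
    qed
    define Hpos where "Hpos = {p \<in> ball c r. n1 * (fst p - fst c) + n2 * (snd p - snd c) > 0}"
    define Hneg where "Hneg = {p \<in> ball c r. (- n1) * (fst p - fst c) + (- n2) * (snd p - snd c) > 0}"
    note Hpos = half_ball[OF r(1) n0, of c, folded Hpos_def]
    have n0': "(- n1, - n2) \<noteq> (0, 0)"
      using n0 by auto
    note Hneg = half_ball[OF r(1) n0', of c, folded Hneg_def]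
    have "Hpos \<inter> frontier (body T') = {}" "Hneg \<inter> frontier (body T') = {}" if "T' \<in> \<T>" for T'
      using front[OF _ _ that] line by (fastforce simp: Hpos_def Hneg_def)+
    moreover have "Hpos \<subseteq> \<Omega>" "Hneg \<subseteq> \<Omega>"
      using r by (auto simp: Hpos_def Hneg_def)
    ultimately obtain T1 T2 where T1: "T1 \<in> \<T>" "Hpos \<subseteq> body T1" and T2: "T2 \<in> \<T>" "Hneg \<subseteq> body T2"
      using half_ball_subset_body[OF Hpos(2,3)] half_ball_subset_body[OF Hneg(2,3)] by blast
    have "c \<in> body T1" "c \<in> body T2"
      using closure_minimal[OF T1(2) closed_body[OF T1(1)]] closure_minimal[OF T2(2) closed_body[OF T2(1)]]
        Hpos(4) Hneg(4) by auto
    then have "e \<in> sides T1" "e \<in> sides T2"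
      using edge_shared[OF assms(2) T(1) ab(2,3) T1(1)] edge_shared[OF assms(2) T(1) ab(2,3) T2(1)]
      by (simp_all add: e_def)
    \<comment> \<open>If both halves lay in one triangle, its body could miss only points of the
      line within the ball. This remainder is open and negligible, hence empty, and \<open>c\<close>
      would be an interior point.\<close>
    moreover have "T1 \<noteq> T2"
    proof
      assume "T1 = T2"
      have "ball c r - body T1 \<subseteq> {p. (n1, n2) \<bullet> p = (n1, n2) \<bullet> c}"
      proof
        fix p assume p: "p \<in> ball c r - body T1"
        then have "p \<notin> Hpos" "p \<notin> Hneg"
          using T1 T2 \<open>T1 = T2\<close> by auto
        with p show "p \<in> {p. (n1, n2) \<bullet> p = (n1, n2) \<bullet> c}"
          by (auto simp: Hpos_def Hneg_def inner_prod_def algebra_simps)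
      qed
      then have "negligible (ball c r - body T1)"
        using negligible_hyperplane[of "(n1, n2)"] n0 negligible_subset by (metis zero_prod_def)
      then have "ball c r - body T1 = {}"
        using open_not_negligible closed_body[OF T1(1)] open_Diff[OF open_ball] by blast
      then have "c \<in> interior (body T1)"
        using r(1) by (intro interiorI[of "ball c r"]) auto
      with 2[OF T1(1)] show False ..
    qed
    ultimately have "e \<in> interior_edges \<T>"
      using T1(1) T2(1) by (auto simp: interior_edges_def)
    then have "n1\<^sup>2 \<noteq> n2\<^sup>2"
      using no_type_I type_I_closed_segment[OF ab(1)] unfolding e_def n1_def n2_def power2_minus by metis
    moreover have "{p \<in> ball c r. n1 * (fst p - fst c) + n2 * (snd p - snd c) < 0} = Hneg"
      by (auto simp: Hneg_def)
    ultimately have "local_split c r n1 n2 T1 T2"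
      using r T1 T2 by (auto simp: local_split_def Hpos_def)
    then show ?thesis
      by blast
  qed
qed

text \<open>The half balls lie in the interiors of \<open>T1\<close> and \<open>T2\<close>, and the
  interior of \<open>T\<close>, being open, is not confined to the line between them; disjointness
  of interiors then identifies \<open>T\<close>.\<close>

lemma local_split_cells:
  assumes s: "local_split c r n1 n2 T1 T2" and T: "T \<in> \<T>" and p: "p \<in> ball c r" "p \<in> closure (interior (body T))"
  shows "T = T1 \<or> T = T2"
proof -
  have n0: "(n1, n2) \<noteq> (0, 0)" "(- n1, - n2) \<noteq> (0, 0)"
    using s by (auto simp: local_split_def)
  define Hpos where "Hpos = {p \<in> ball c r. n1 * (fst p - fst c) + n2 * (snd p - snd c) > 0}"
  define Hneg where "Hneg = {p \<in> ball c r. (- n1) * (fst p - fst c) + (- n2) * (snd p - snd c) > 0}"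
  have "0 < r"
    using s by (simp add: local_split_def)
  have "open Hpos" "open Hneg"
    unfolding Hpos_def Hneg_def using half_ball(1)[OF \<open>0 < r\<close>] n0 by blast+
  moreover have "Hpos \<subseteq> body T1" "Hneg \<subseteq> body T2"
    using s by (auto simp: local_split_def Hpos_def Hneg_def)
  ultimately have H: "Hpos \<subseteq> interior (body T1)" "Hneg \<subseteq> interior (body T2)"
    by (auto intro: interior_maximal[THEN subsetD])
  have "interior (body T) \<inter> ball c r \<noteq> {}"
    using p open_Int_closure_eq_empty[OF open_ball, of c r "interior (body T)"] by auto
  then have "\<exists>q\<in>interior (body T) \<inter> ball c r. n1 * (fst q - fst c) + n2 * (snd q - snd c) \<noteq> 0"
    by (intro open_not_subset_line n0(1)) auto
  then obtain q where q: "q \<in> interior (body T)" "q \<in> ball c r"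
    and "n1 * (fst q - fst c) + n2 * (snd q - snd c) \<noteq> 0"
    by blast
  then have "q \<in> Hpos \<or> q \<in> Hneg"
    by (auto simp: Hpos_def Hneg_def)
  moreover have "T1 \<in> \<T>" "T2 \<in> \<T>"
    using s by (simp_all add: local_split_def)
  ultimately show ?thesis
    using H q interiors_disjoint[OF T, of T1] interiors_disjoint[OF T, of T2] by blast
qed

text \<open>Points in the closure of the interior are limits of interior points, and these determine
  the triangle. On an edge the choice between the two neighbours is arbitrary.\<close>

definition cell :: "plane \<Rightarrow> triangle" where
  "cell p = (SOME T. T \<in> \<T> \<and> p \<in> closure (interior (body T)))"

lemma cell:
  assumes "p \<in> \<Omega> - nodes"
  shows "cell p \<in> \<T>" "p \<in> closure (interior (body (cell p)))"
proof -
  obtain r n1 n2 T1 T2 where s: "local_split p r n1 n2 T1 T2"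
    using local_split_exists[of p] assms by blast
  define H where "H = {q \<in> ball p r. n1 * (fst q - fst p) + n2 * (snd q - snd p) > 0}"
  have "0 < r" "(n1, n2) \<noteq> (0, 0)"
    using s by (auto simp: local_split_def)
  note H = half_ball[OF this, of p, folded H_def]
  have "H \<subseteq> interior (body T1)"
    using s H(1) by (intro interior_maximal) (auto simp: local_split_def H_def)
  then have "p \<in> closure (interior (body T1))"
    using H(4) closure_mono by blast
  then have "\<exists>T. T \<in> \<T> \<and> p \<in> closure (interior (body T))"
    using s by (auto simp: local_split_def)
  then show "cell p \<in> \<T>" "p \<in> closure (interior (body (cell p)))"
    unfolding cell_def by (metis (mono_tags, lifting) someI_ex)+
qed

lemma cell_interior:
  assumes "T \<in> \<T>" "p \<in> interior (body T)"
  shows "cell p = T"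
proof -
  have "T' = T" if "T' \<in> \<T>" "p \<in> closure (interior (body T'))" for T'
    using that assms interiors_disjoint[of T T'] open_Int_closure_eq_empty[OF open_interior, of "body T" "interior (body T')"]
    by auto
  moreover have "T \<in> \<T> \<and> p \<in> closure (interior (body T))"
    using assms closure_subset by blast
  ultimately show ?thesis
    unfolding cell_def by (intro some_equality) blast+
qed

text \<open>Near \<open>c\<close> only the branches \<open>Q T1\<close> and \<open>Q T2\<close>
  occur. Both are continuous with the same value at \<open>c\<close>, so it does not matter how
  \<open>cell\<close> switches between them.\<close>

lemma cell_continuous:
  assumes s: "local_split c r n1 n2 T1 T2" and eq: "Q T1 c = (Q T2 c :: real)"
    and Q: "\<And>T. continuous_on UNIV (Q T)"
  shows "isCont (\<lambda>p. Q (cell p) p) c"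
proof -
  have r: "0 < r" and sub: "ball c r \<subseteq> \<Omega> - nodes"
    using s by (auto simp: local_split_def)
  have cells: "cell p = T1 \<or> cell p = T2" if "p \<in> ball c r" for p
  proof -
    have "p \<in> \<Omega> - nodes"
      using sub that by blast
    then show ?thesis
      using local_split_cells[OF s cell(1) that cell(2)] by blast
  qed
  have lim: "isCont (Q T) c" for T
    using Q[of T] continuous_on_eq_continuous_at[OF open_UNIV, of "Q T"] by blast
  have c: "Q (cell c) c = Q T1 c"
    using cells[of c] r eq by auto
  show ?thesis
    unfolding continuous_at_eps_delta
  proof (intro allI impI)
    fix e :: real assume "0 < e"
    obtain d1 where d1: "d1 > 0" "\<And>p. dist p c < d1 \<Longrightarrow> dist (Q T1 p) (Q T1 c) < e"
      using lim[of T1] \<open>0 < e\<close> unfolding continuous_at_eps_delta by blast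
    obtain d2 where d2: "d2 > 0" "\<And>p. dist p c < d2 \<Longrightarrow> dist (Q T2 p) (Q T2 c) < e"
      using lim[of T2] \<open>0 < e\<close> unfolding continuous_at_eps_delta by blast
    have "dist (Q (cell p) p) (Q (cell c) c) < e" if "dist p c < min r (min d1 d2)" for p
      using cells[of p] that d1(2)[of p] d2(2)[of p] eq unfolding c by (auto simp: dist_commute)
    then show "\<exists>d>0. \<forall>p. dist p c < d \<longrightarrow> dist (Q (cell p) p) (Q (cell c) c) < e"
      using d1 d2 r by (intro exI[of _ "min r (min d1 d2)"]) auto
  qed
qed

end

section \<open>Weak derivatives of continuous piecewise polynomials\<close>

text \<open>\<open>C\<close> holds the heights of exceptional lines and \<open>B\<close> the points
  where \<open>w'\<close> need not be the derivative. On every other line \<open>B\<close> leaves a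
  finite set, which the fundamental theorem of calculus tolerates for continuous
  \<open>w\<close>.\<close>

lemma integral_x_derivative_eq_0:
  fixes w w' :: "plane \<Rightarrow> real"
  assumes int: "integrable lborel w'" and "finite C"
    and cont: "\<And>y. y \<notin> C \<Longrightarrow> continuous_on UNIV (\<lambda>x. w (x, y))"
    and fin: "\<And>y. y \<notin> C \<Longrightarrow> finite {x. (x, y) \<in> B}"
    and der: "\<And>x y. (x, y) \<notin> B \<Longrightarrow> ((\<lambda>t. w (t, y)) has_real_derivative w' (x, y)) (at x)"
    and supp: "\<And>x y. \<bar>x\<bar> > R \<Longrightarrow> w (x, y) = 0"
  shows "(\<integral>p. w' p \<partial>lborel) = 0"
proof -
  have i: "integrable (lborel \<Otimes>\<^sub>M lborel) (\<lambda>(x, y). w' (x, y))"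
    using int by (simp add: lborel_prod)
  have "AE y in lborel. integrable lborel (\<lambda>x. w' (x, y))"
    using lborel_pair.AE_integrable_snd[OF i] .
  moreover have "AE y in lborel. y \<notin> C"
    using \<open>finite C\<close> by (intro AE_not_in finite_imp_null_set_lborel)
  ultimately have "AE y in lborel. (\<integral>x. w' (x, y) \<partial>lborel) = 0"
  proof eventually_elim
    case (elim y)
    \<comment> \<open>Strictly beyond \<open>R\<close>, so that \<open>w\<close> vanishes at both
      endpoints, and positive even if \<open>R\<close> is not.\<close>
    define a where "a = \<bar>R\<bar> + 1"
    define E where "E = {x. (x, y) \<in> B}"
    have "finite E"
      using fin elim by (simp add: E_def)
    have d: "((\<lambda>t. w (t, y)) has_real_derivative w' (x, y)) (at x)" if "x \<notin> E" for x
      using der that by (auto simp: E_def)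
    have "((\<lambda>x. w' (x, y)) has_integral (w (a, y) - w (- a, y))) {- a..a}"
    proof (rule fundamental_theorem_of_calculus_interior_strong[OF \<open>finite E\<close>])
      show "((\<lambda>t. w (t, y)) has_vector_derivative w' (x, y)) (at x)" if "x \<in> {- a<..<a} - E" for x
        using d that by (simp add: has_real_derivative_iff_has_vector_derivative)
      show "continuous_on {- a..a} (\<lambda>t. w (t, y))"
        using cont[OF elim(2)] by (rule continuous_on_subset) auto
    qed (simp add: a_def)
    then have "((\<lambda>x. w' (x, y)) has_integral 0) {- a..a}"
      using supp[of a y] supp[of "- a" y] by (simp add: a_def)
    then have 1: "((\<lambda>x. if x \<in> {- a..a} then w' (x, y) else 0) has_integral 0) UNIV"
      by (simp only: has_integral_restrict_UNIV)
    have "((\<lambda>x. w' (x, y)) has_integral 0) UNIV"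
    proof (rule has_integral_spike_finite[OF \<open>finite E\<close> _ 1])
      fix x assume x: "x \<in> UNIV - E"
      \<comment> \<open>Here \<open>w\<close> is zero in a neighbourhood, so uniqueness of the
        derivative forces \<open>w'\<close> to vanish.\<close>
      have "w' (x, y) = 0" if "x \<notin> {- a..a}"
      proof -
        have "\<forall>\<^sub>F t in nhds x. t \<notin> {- a..a}"
          using that eventually_nhds_in_open[of "- {- a..a}" x] by (simp add: open_Compl)
        then have "\<forall>\<^sub>F t in nhds x. w (t, y) = 0"
          by eventually_elim (auto intro!: supp simp: a_def)
        then have "((\<lambda>t. w (t, y)) has_real_derivative 0) (at x)"
          by (subst DERIV_cong_ev[OF refl _ refl, where g = "\<lambda>_. 0"]) auto
        then show ?thesis
          using d[of x] x DERIV_unique by blast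
      qed
      then show "w' (x, y) = (if x \<in> {- a..a} then w' (x, y) else 0)"
        by auto
    qed
    then show ?case
      using has_integral_integral_lborel[OF elim(1)] has_integral_unique by blast
  qed
  then have "(\<integral>y. (\<integral>x. w' (x, y) \<partial>lborel) \<partial>lborel) = (\<integral>y. 0 \<partial>(lborel :: real measure))"
    by (intro integral_cong_AE borel_measurable_integrable[OF lborel_pair.integrable_snd[OF i]]) auto
  then show ?thesis
    using lborel_pair.integral_snd[OF i] by (simp add: lborel_prod)
qed

text \<open>Reflection in the diagonal, by which the case of vertical lines follows from that of
  horizontal ones.\<close>

lemma integral_swap:
  fixes f :: "plane \<Rightarrow> real"
  assumes "integrable lborel f"
  shows "integrable lborel (\<lambda>p. f (snd p, fst p))" "(\<integral>p. f (snd p, fst p) \<partial>lborel) = (\<integral>p. f p \<partial>lborel)"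
proof -
  have i: "integrable (lborel \<Otimes>\<^sub>M lborel) f"
    using assms by (simp add: lborel_prod)
  show "integrable lborel (\<lambda>p. f (snd p, fst p))"
    using lborel_pair.integrable_product_swap[OF i] by (simp add: lborel_prod case_prod_unfold)
  show "(\<integral>p. f (snd p, fst p) \<partial>lborel) = (\<integral>p. f p \<partial>lborel)"
    using lborel_pair.integral_product_swap[OF borel_measurable_integrable[OF i]]
    by (simp add: lborel_prod case_prod_unfold)
qed

text \<open>\<open>F\<close> holds the points where continuity may fail, \<open>B\<close> those
  where the derivative may. A line whose coordinate is outside the projection of \<open>F\<close>
  misses \<open>F\<close> altogether, and only finitely many lines are lost in each
  direction.\<close>

lemma integral_partials_eq_0:
  fixes w wx wy :: "plane \<Rightarrow> real"
  assumes int: "integrable lborel wx" "integrable lborel wy" and "finite F"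
    and cont: "\<And>p. p \<notin> F \<Longrightarrow> isCont w p"
    and fin: "\<And>y. y \<notin> snd ` F \<Longrightarrow> finite {x. (x, y) \<in> B}" "\<And>x. x \<notin> fst ` F \<Longrightarrow> finite {y. (x, y) \<in> B}"
    and der: "\<And>p. p \<notin> B \<Longrightarrow> (w has_derivative (\<lambda>h. wx p * fst h + wy p * snd h)) (at p)"
    and supp: "\<And>p. norm p > R \<Longrightarrow> w p = 0"
  shows "(\<integral>p. wx p \<partial>lborel) = 0 \<and> (\<integral>p. wy p \<partial>lborel) = 0"
proof
  have supp1: "w (x, y) = 0" if "\<bar>x\<bar> > R \<or> \<bar>y\<bar> > R" for x y
    using that norm_fst_le[of x y] norm_snd_le[of y x] by (intro supp) auto
  show "(\<integral>p. wx p \<partial>lborel) = 0"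
  proof (rule integral_x_derivative_eq_0[OF int(1), where w = w and C = "snd ` F" and B = B and R = R])
    show "continuous_on UNIV (\<lambda>x. w (x, y))" if "y \<notin> snd ` F" for y
    proof (intro continuous_at_imp_continuous_on ballI)
      fix x
      have "(x, y) \<notin> F"
        using that by (metis image_eqI snd_conv)
      then show "isCont (\<lambda>x. w (x, y)) x"
        by (intro isCont_o2[where f = "\<lambda>x. (x, y)" and g = w] cont continuous_intros)
    qed
    show "((\<lambda>t. w (t, y)) has_real_derivative wx (x, y)) (at x)" if "(x, y) \<notin> B" for x y
      using has_derivative_imp_partials(1)[OF der[OF that]] by simp
  qed (use assms supp1 in auto)
  have "(\<integral>p. wy (snd p, fst p) \<partial>lborel) = 0"
  proof (rule integral_x_derivative_eq_0[where w = "\<lambda>p. w (snd p, fst p)" and C = "fst ` F"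
        and B = "{p. (snd p, fst p) \<in> B}" and R = R])
    show "continuous_on UNIV (\<lambda>y. w (snd (y, x), fst (y, x)))" if "x \<notin> fst ` F" for x
    proof (intro continuous_at_imp_continuous_on ballI)
      fix y
      have "(x, y) \<notin> F"
        using that by (metis image_eqI fst_conv)
      then have "isCont (\<lambda>y. w (x, y)) y"
        by (intro isCont_o2[where f = "\<lambda>y. (x, y)" and g = w] cont continuous_intros)
      then show "isCont (\<lambda>y. w (snd (y, x), fst (y, x))) y"
        by simp
    qed
    show "((\<lambda>t. w (snd (t, x), fst (t, x))) has_real_derivative wy (snd (y, x), fst (y, x))) (at y)"
      if "(y, x) \<notin> {p. (snd p, fst p) \<in> B}" for x y
      using has_derivative_imp_partials(2)[OF der, of "(x, y)"] that by simp
  qed (use assms supp1 integral_swap[OF int(2)] in auto)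
  then show "(\<integral>p. wy p \<partial>lborel) = 0"
    using integral_swap(2)[OF int(2)] by simp
qed

text \<open>The parameter of a common point solves a linear equation that is not satisfied at the
  endpoint, hence not identically, so there is at most one solution.\<close>

lemma closed_segment_meets_line:
  fixes a b :: plane
  shows "y \<notin> {snd a, snd b} \<Longrightarrow> finite {x. (x, y) \<in> closed_segment a b}"
    and "x \<notin> {fst a, fst b} \<Longrightarrow> finite {y. (x, y) \<in> closed_segment a b}"
proof -
  have fin: "finite {u :: real. (1 - u) * r + u * s = t}" if "t \<noteq> r" for r s t
  proof (rule finite_subset)
    show "{u. (1 - u) * r + u * s = t} \<subseteq> {(t - r) / (s - r)}"
    proof
      fix u assume "u \<in> {u. (1 - u) * r + u * s = t}"
      then have "u * (s - r) = t - r"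
        by (simp add: algebra_simps)
      moreover from this have "s - r \<noteq> 0"
        using that by auto
      ultimately show "u \<in> {(t - r) / (s - r)}"
        by (simp add: eq_divide_eq)
    qed
  qed simp
  have seg: "\<exists>u. (1 - u) * fst a + u * fst b = x \<and> (1 - u) * snd a + u * snd b = y"
    if "(x, y) \<in> closed_segment a b" for x y
  proof -
    obtain u where u: "(x, y) = (1 - u) *\<^sub>R a + u *\<^sub>R b"
      using \<open>(x, y) \<in> closed_segment a b\<close> unfolding in_segment by blast
    show ?thesis
      using arg_cong[OF u, of fst] arg_cong[OF u, of snd] by auto
  qed
  show "finite {x. (x, y) \<in> closed_segment a b}" if "y \<notin> {snd a, snd b}"
  proof (rule finite_subset)
    show "{x. (x, y) \<in> closed_segment a b} \<subseteq>
        (\<lambda>u. (1 - u) * fst a + u * fst b) ` {u. (1 - u) * snd a + u * snd b = y}"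
      using seg by blast
  qed (use that fin[of y "snd a" "snd b"] in simp)
  show "finite {y. (x, y) \<in> closed_segment a b}" if "x \<notin> {fst a, fst b}"
  proof (rule finite_subset)
    show "{y. (x, y) \<in> closed_segment a b} \<subseteq>
        (\<lambda>u. (1 - u) * snd a + u * snd b) ` {u. (1 - u) * fst a + u * fst b = x}"
      using seg by blast
  qed (use that fin[of x "fst a" "fst b"] in simp)
qed

lemma test_functionD:
  assumes "\<phi> \<in> test_functions \<Omega>"
  shows "(\<phi> has_derivative (\<lambda>h. partial_x \<phi> p * fst h + partial_y \<phi> p * snd h)) (at p)"
    and "continuous_on UNIV \<phi>" "continuous_on UNIV (partial_x \<phi>)" "continuous_on UNIV (partial_y \<phi>)"
    and "\<exists>K. compact K \<and> K \<subseteq> \<Omega> \<and> (\<forall>p. p \<notin> K \<longrightarrow> \<phi> p = 0 \<and> partial_x \<phi> p = 0 \<and> partial_y \<phi> p = 0)"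
proof -
  have Ck: "Ck_function k \<phi>" for k
    using assms by (simp add: test_functions_def)
  have diff: "\<phi> differentiable_on UNIV"
    using Ck[of 1] by simp
  show "continuous_on UNIV \<phi>" "continuous_on UNIV (partial_x \<phi>)" "continuous_on UNIV (partial_y \<phi>)"
    using Ck[of 0] Ck[of 1] by auto
  have der: "(\<phi> has_derivative (\<lambda>h. partial_x \<phi> p * fst h + partial_y \<phi> p * snd h)) (at p)" for p
  proof -
    obtain D where D: "(\<phi> has_derivative D) (at p)"
      using diff unfolding differentiable_on_def differentiable_def by blast
    interpret D: bounded_linear D
      using D by (rule has_derivative_bounded_linear)
    have "D h = partial_x \<phi> p * fst h + partial_y \<phi> p * snd h" for h
    proof -
      have "D h = D (fst h *\<^sub>R (1, 0) + snd h *\<^sub>R (0, 1))"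
        by simp
      also have "\<dots> = fst h * D (1, 0) + snd h * D (0, 1)"
        by (simp only: D.add D.scaleR real_scaleR_def)
      finally show ?thesis
        by (simp add: has_derivative_imp_partials(3,4)[OF D] mult.commute)
    qed
    then have "D = (\<lambda>h. partial_x \<phi> p * fst h + partial_y \<phi> p * snd h)"
      by (rule ext)
    with D show ?thesis
      by simp
  qed
  then show "(\<phi> has_derivative (\<lambda>h. partial_x \<phi> p * fst h + partial_y \<phi> p * snd h)) (at p)" .
  define K where "K = closure {p. \<phi> p \<noteq> 0}"
  have open_K: "open (- K)"
    by (simp add: K_def open_Compl)
  have zero: "\<phi> p = 0" if "p \<notin> K" for p
    using that closure_subset[of "{p. \<phi> p \<noteq> 0}"] by (auto simp: K_def)
  have "partial_x \<phi> p = 0 \<and> partial_y \<phi> p = 0" if "p \<notin> K" for p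
  proof -
    have "((\<lambda>_. 0) has_derivative (\<lambda>_. 0)) (at p)"
      by simp
    then have "(\<phi> has_derivative (\<lambda>_. 0)) (at p)"
      by (rule has_derivative_transform_within_open[OF _ open_K]) (use that zero in auto)
    then show ?thesis
      by (simp add: has_derivative_imp_partials)
  qed
  moreover have "compact K" "K \<subseteq> \<Omega>"
    using assms by (simp_all add: test_functions_def K_def)
  ultimately show "\<exists>K. compact K \<and> K \<subseteq> \<Omega> \<and> (\<forall>p. p \<notin> K \<longrightarrow> \<phi> p = 0 \<and> partial_x \<phi> p = 0 \<and> partial_y \<phi> p = 0)"
    using zero by blast
qed

section \<open>Piecewise functions on the mesh and integration by parts\<close>

context mesh
begin

text \<open>Segments between all pairs of nodes, so that no straight sides need to be singled out.
  This finite union contains every side that meets the domain, and it is still negligible and meets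
  all but finitely many horizontal and vertical lines in finite sets.\<close>

definition skeleton :: "plane set" where
  "skeleton = (\<Union>a\<in>nodes. \<Union>b\<in>nodes. closed_segment a b)"

lemma off_skeleton:
  assumes "p \<in> \<Omega>" "p \<notin> skeleton"
  obtains T where "T \<in> \<T>" "p \<in> interior (body T)"
proof -
  obtain T where T: "T \<in> \<T>" "p \<in> body T"
    using domain_covered assms by blast
  have "p \<in> interior (body T)"
  proof (rule ccontr)
    assume "p \<notin> interior (body T)"
    then obtain a b where "a \<in> vertices T" "b \<in> vertices T" "p \<in> closed_segment a b"
      using boundary_point_on_segment[OF assms(1) T] by metis
    with T(1) assms(2) show False
      unfolding skeleton_def nodes_def by blast
  qed
  with T that show ?thesis
    by blast
qed

lemma skeleton_meets_line:
  "y \<notin> snd ` nodes \<Longrightarrow> finite {x. (x, y) \<in> skeleton}"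
  "x \<notin> fst ` nodes \<Longrightarrow> finite {y. (x, y) \<in> skeleton}"
proof -
  assume y: "y \<notin> snd ` nodes"
  have "{x. (x, y) \<in> skeleton} = (\<Union>a\<in>nodes. \<Union>b\<in>nodes. {x. (x, y) \<in> closed_segment a b})"
    unfolding skeleton_def by blast
  also have "finite \<dots>"
    by (intro finite_UN_I finite_nodes closed_segment_meets_line(1)) (use y in blast)
  finally show "finite {x. (x, y) \<in> skeleton}" .
next
  assume x: "x \<notin> fst ` nodes"
  have "{y. (x, y) \<in> skeleton} = (\<Union>a\<in>nodes. \<Union>b\<in>nodes. {y. (x, y) \<in> closed_segment a b})"
    unfolding skeleton_def by blast
  also have "finite \<dots>"
    by (intro finite_UN_I finite_nodes closed_segment_meets_line(2)) (use x in blast)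
  finally show "finite {y. (x, y) \<in> skeleton}" .
qed

lemma negligible_skeleton: "negligible skeleton"
proof -
  have "negligible (closed_segment a b)" for a b :: plane
  proof (rule negligible_convex_interior[THEN iffD2])
    show "interior (closed_segment a b) = {}"
      by (simp add: interior_closed_segment_ge2)
  qed simp
  then show ?thesis
    unfolding skeleton_def using finite_nodes by (intro negligible_Union) auto
qed

text \<open>A second representative besides \<open>Q (cell p) p\<close>: this one is visibly Borel
  measurable, while that one can be continuous across edges. They agree in the interior of every
  triangle, hence in the domain off \<open>skeleton\<close>.\<close>

definition piecewise :: "(triangle \<Rightarrow> plane \<Rightarrow> real) \<Rightarrow> plane \<Rightarrow> real" where
  "piecewise Q p = (\<Sum>T\<in>\<T>. indicator (interior (body T)) p * Q T p)"

lemma piecewise_interior: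
  assumes "T \<in> \<T>" "p \<in> interior (body T)"
  shows "piecewise Q p = Q T p"
proof -
  have "piecewise Q p = (\<Sum>S\<in>\<T>. if S = T then Q T p else 0)"
    unfolding piecewise_def
    using assms interiors_disjoint by (intro sum.cong) (auto simp: indicator_def)
  then show ?thesis
    using assms(1) finite_mesh by simp
qed

lemma borel_measurable_piecewise:
  assumes "\<And>T. continuous_on UNIV (Q T)"
  shows "piecewise Q \<in> borel_measurable borel"
proof -
  have [measurable]: "Q T \<in> borel_measurable borel" for T
    using assms by (intro borel_measurable_continuous_onI)
  have [measurable]: "interior (body T) \<in> sets borel" for T
    by simp
  show ?thesis
    unfolding piecewise_def[abs_def] by measurable
qed

lemma integrable_piecewise_mult:
  assumes "\<And>T. continuous_on UNIV (Q T)" "continuous_on UNIV \<phi>" "\<And>p. norm p > R \<Longrightarrow> \<phi> p = 0"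
  shows "integrable lborel (\<lambda>p. piecewise Q p * \<phi> p)"
proof -
  have "integrable lborel (\<lambda>p. indicator (interior (body T)) p *\<^sub>R (Q T p * \<phi> p))" for T
    using assms by (intro integrable_mult_indicator integrable_continuous_compact_support[where R = R])
      (auto intro!: continuous_intros)
  then have "integrable lborel (\<lambda>p. \<Sum>T\<in>\<T>. indicator (interior (body T)) p *\<^sub>R (Q T p * \<phi> p))"
    by (intro Bochner_Integration.integrable_sum)
  then show ?thesis
    by (simp add: piecewise_def sum_distrib_right mult.assoc)
qed

lemma piecewise_in_L2:
  assumes "\<And>T. continuous_on UNIV (Q T)"
  shows "piecewise Q \<in> L2 \<Omega>"
proof -
  have "\<exists>M. \<forall>p\<in>body T. \<bar>Q T p\<bar> \<le> M" if "T \<in> \<T>" for T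
  proof -
    have "compact (Q T ` body T)"
      using assms is_triangleD(1)[OF mesh_triangle[OF that]]
      by (intro compact_continuous_image) (auto intro: continuous_on_subset)
    then show ?thesis
      using compact_imp_bounded[of "Q T ` body T"] by (auto simp: bounded_iff)
  qed
  then obtain M where M: "\<And>T p. T \<in> \<T> \<Longrightarrow> p \<in> body T \<Longrightarrow> \<bar>Q T p\<bar> \<le> M T"
    by metis
  have bound: "\<bar>piecewise Q p\<bar> \<le> (\<Sum>T\<in>\<T>. \<bar>M T\<bar>)" for p
    unfolding piecewise_def
  proof (rule order_trans[OF sum_abs], rule sum_mono)
    fix T assume "T \<in> \<T>"
    then show "\<bar>indicator (interior (body T)) p * Q T p\<bar> \<le> \<bar>M T\<bar>"
      using M[of T p] interior_subset[of "body T"] by (force simp: indicator_def)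
  qed
  have meas: "piecewise Q \<in> borel_measurable (lebesgue_on \<Omega>)"
    using borel_measurable_piecewise[OF assms]
    by (intro measurable_restrict_space1 measurable_completion) simp
  interpret finite_measure "lebesgue_on \<Omega>"
    by (intro finite_measure_lebesgue_on lmeasurable_open bounded_domain open_domain)
  have "integrable (lebesgue_on \<Omega>) (\<lambda>p. (piecewise Q p)\<^sup>2)"
  proof (rule integrable_const_bound)
    show "AE p in lebesgue_on \<Omega>. norm ((piecewise Q p)\<^sup>2) \<le> (\<Sum>T\<in>\<T>. \<bar>M T\<bar>)\<^sup>2"
      using bound by (intro AE_I2) (simp add: abs_le_square_iff[symmetric] sum_nonneg)
    show "(\<lambda>p. (piecewise Q p)\<^sup>2) \<in> borel_measurable (lebesgue_on \<Omega>)"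
      using meas by (rule borel_measurable_power)
  qed
  with meas show ?thesis
    by (simp add: L2_def)
qed

text \<open>The \<open>cell\<close> representative times a test function is continuous off the nodes
  and differentiable off the skeleton, on the whole plane. That its partial derivatives integrate to
  zero is the integration by parts.\<close>

lemma weak_partials_piecewise:
  assumes der: "\<And>T p. (Q T has_derivative (\<lambda>h. Qx T p * fst h + Qy T p * snd h)) (at p)"
    and cont: "\<And>T. continuous_on UNIV (Qx T)" "\<And>T. continuous_on UNIV (Qy T)"
    and match: "\<And>p. p \<in> \<Omega> - nodes \<Longrightarrow> isCont (\<lambda>p. Q (cell p) p) p"
  shows "weak_partial_x \<Omega> (piecewise Q) (piecewise Qx)" "weak_partial_y \<Omega> (piecewise Q) (piecewise Qy)"
proof -
  have contQ: "continuous_on UNIV (Q T)" for T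
    using der by (intro continuous_at_imp_continuous_on) (auto intro: has_derivative_continuous)
  have main: "(\<integral>p. piecewise Q p * partial_x \<phi> p \<partial>lebesgue_on \<Omega>) = - (\<integral>p. piecewise Qx p * \<phi> p \<partial>lebesgue_on \<Omega>) \<and>
      (\<integral>p. piecewise Q p * partial_y \<phi> p \<partial>lebesgue_on \<Omega>) = - (\<integral>p. piecewise Qy p * \<phi> p \<partial>lebesgue_on \<Omega>)"
    if \<phi>: "\<phi> \<in> test_functions \<Omega>" for \<phi>
  proof -
    note t = test_functionD(1-4)[OF \<phi>]
    obtain K where K: "compact K" "K \<subseteq> \<Omega>"
      and off: "\<And>p. p \<notin> K \<Longrightarrow> \<phi> p = 0 \<and> partial_x \<phi> p = 0 \<and> partial_y \<phi> p = 0"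
      using test_functionD(5)[OF \<phi>] by blast
    obtain R where "\<And>p. p \<in> K \<Longrightarrow> norm p \<le> R"
      using compact_imp_bounded[OF K(1)] by (auto simp: bounded_iff)
    then have R: "\<phi> p = 0" "partial_x \<phi> p = 0" "partial_y \<phi> p = 0" if "norm p > R" for p
      using off[of p] that by fastforce+
    \<comment> \<open>The factor supported in \<open>K\<close> turns an integral over \<Omega> into
      one over the plane, and a Borel integrand replaces Lebesgue measure by \<open>lborel\<close>,
      which is a product measure as Fubini requires.\<close>
    have restrict: "(\<integral>p. piecewise P p * \<psi> p \<partial>lebesgue_on \<Omega>) = (\<integral>p. piecewise P p * \<psi> p \<partial>lborel)"
      if "\<And>T. continuous_on UNIV (P T)" "continuous_on UNIV \<psi>" "\<And>p. p \<notin> K \<Longrightarrow> \<psi> p = 0" for P \<psi>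
    proof -
      have "(\<integral>p. piecewise P p * \<psi> p \<partial>lebesgue_on \<Omega>) = (\<integral>p. indicator \<Omega> p *\<^sub>R (piecewise P p * \<psi> p) \<partial>lebesgue)"
        using open_domain by (intro integral_restrict_space) auto
      also have "(\<lambda>p. indicator \<Omega> p *\<^sub>R (piecewise P p * \<psi> p)) = (\<lambda>p. piecewise P p * \<psi> p)"
        using that(3) K(2) by (auto simp: fun_eq_iff indicator_def)
      also have "(\<integral>p. piecewise P p * \<psi> p \<partial>lebesgue) = (\<integral>p. piecewise P p * \<psi> p \<partial>lborel)"
        using borel_measurable_piecewise[OF that(1)] borel_measurable_continuous_onI[OF that(2)]
        by (intro integral_completion) simp
      finally show ?thesis .
    qed
    \<comment> \<open>Continuity is asked of \<open>w\<close>, which uses \<open>cell\<close>;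
      integrability is asked of \<open>wx\<close> and \<open>wy\<close>, which use
      \<open>piecewise\<close>.\<close>
    define w where "w = (\<lambda>p. Q (cell p) p * \<phi> p)"
    define wx where "wx = (\<lambda>p. piecewise Q p * partial_x \<phi> p + piecewise Qx p * \<phi> p)"
    define wy where "wy = (\<lambda>p. piecewise Q p * partial_y \<phi> p + piecewise Qy p * \<phi> p)"
    have open_K: "open (- K)"
      using K(1) by (intro open_Compl compact_imp_closed)
    have i: "integrable lborel (\<lambda>p. piecewise Q p * partial_x \<phi> p)" "integrable lborel (\<lambda>p. piecewise Qx p * \<phi> p)"
      "integrable lborel (\<lambda>p. piecewise Q p * partial_y \<phi> p)" "integrable lborel (\<lambda>p. piecewise Qy p * \<phi> p)"
      using contQ cont t R by (auto intro!: integrable_piecewise_mult[where R = R])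
    have zero: "(\<integral>p. wx p \<partial>lborel) = 0 \<and> (\<integral>p. wy p \<partial>lborel) = 0"
    proof (rule integral_partials_eq_0[where w = w and wx = wx and wy = wy and F = nodes and B = skeleton and R = R])
      show "integrable lborel wx" "integrable lborel wy"
        unfolding wx_def wy_def using i by auto
      show "isCont w p" if "p \<notin> nodes" for p
      proof (cases "p \<in> K")
        case True
        then have "isCont (\<lambda>p. Q (cell p) p) p"
          using K(2) that match[of p] by blast
        moreover have "isCont \<phi> p"
          using t(2) continuous_on_eq_continuous_at[OF open_UNIV, of \<phi>] by blast
        ultimately show ?thesis
          unfolding w_def by (rule isCont_mult)
      next
        \<comment> \<open>Outside \<Omega> the choice made by \<open>cell\<close> carries no
          information, but the factor \<open>\<phi>\<close> vanishes on the whole complement of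
          \<open>K\<close>.\<close>
        case False
        have "isCont (\<lambda>p. 0 :: real) p"
          by simp
        moreover have "\<forall>\<^sub>F q in nhds p. w q = 0"
          using eventually_nhds_in_open[OF open_K, of p] False off by (auto simp: w_def elim!: eventually_mono)
        ultimately show ?thesis
          using isCont_cong[of w "\<lambda>p. 0" p] by simp
      qed
      show "(w has_derivative (\<lambda>h. wx p * fst h + wy p * snd h)) (at p)" if p: "p \<notin> skeleton" for p
      proof (cases "p \<in> K")
        case True
        obtain T where T: "T \<in> \<T>" "p \<in> interior (body T)"
          by (rule off_skeleton[OF subsetD[OF K(2) True] p])
        have "((\<lambda>q. Q T q * \<phi> q) has_derivative
            (\<lambda>h. Q T p * (partial_x \<phi> p * fst h + partial_y \<phi> p * snd h) + (Qx T p * fst h + Qy T p * snd h) * \<phi> p)) (at p)"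
          by (rule has_derivative_mult[OF der t(1)])
        then have "(w has_derivative
            (\<lambda>h. Q T p * (partial_x \<phi> p * fst h + partial_y \<phi> p * snd h) + (Qx T p * fst h + Qy T p * snd h) * \<phi> p)) (at p)"
          by (rule has_derivative_transform_within_open[OF _ open_interior T(2)])
             (simp add: w_def cell_interior[OF T(1)])
        then show ?thesis
          by (rule has_derivative_eq_rhs) (simp add: fun_eq_iff wx_def wy_def piecewise_interior[OF T] algebra_simps)
      next
        case False
        have "((\<lambda>q. 0) has_derivative (\<lambda>h. 0)) (at p)"
          by simp
        then have "(w has_derivative (\<lambda>h. 0)) (at p)"
          by (rule has_derivative_transform_within_open[OF _ open_K]) (use False off in \<open>auto simp: w_def\<close>)
        then show ?thesis
          using off[OF False] by (simp add: wx_def wy_def)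
      qed
      show "w p = 0" if "norm p > R" for p
        using R(1)[OF that] by (simp add: w_def)
    qed (use finite_nodes skeleton_meets_line in auto)
    have "(\<integral>p. piecewise Q p * partial_x \<phi> p \<partial>lborel) = - (\<integral>p. piecewise Qx p * \<phi> p \<partial>lborel)"
      "(\<integral>p. piecewise Q p * partial_y \<phi> p \<partial>lborel) = - (\<integral>p. piecewise Qy p * \<phi> p \<partial>lborel)"
      using zero i by (simp_all add: wx_def wy_def)
    then show ?thesis
      using contQ cont t off by (simp add: restrict)
  qed
  show "weak_partial_x \<Omega> (piecewise Q) (piecewise Qx)" "weak_partial_y \<Omega> (piecewise Q) (piecewise Qy)"
    using main by (auto simp: weak_partial_x_def weak_partial_y_def)
qed

end

section \<open>Piecewise polynomials in the energy space\<close>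

context mesh
begin

lemma AE_lebesgue_on_body:
  assumes "T \<in> \<T>" "AE p in lebesgue_on (body T). P p"
  shows "AE p in lebesgue. p \<in> body T \<longrightarrow> P p"
  using assms(2) closed_body[OF assms(1)] by (simp add: AE_restrict_space_iff)

lemma AE_eq_piecewise:
  assumes "\<And>T. T \<in> \<T> \<Longrightarrow> AE p in lebesgue_on (body T). v p = Q T p"
  shows "AE p in lebesgue_on \<Omega>. v p = piecewise Q p"
proof -
  have "AE p in lebesgue. \<forall>T\<in>\<T>. p \<in> body T \<longrightarrow> v p = Q T p"
    using assms AE_lebesgue_on_body finite_mesh by (intro AE_finite_allI) auto
  moreover have "AE p in lebesgue. p \<notin> skeleton"
    using negligible_skeleton by (intro AE_not_in) (simp add: negligible_iff_null_sets)
  ultimately have "AE p in lebesgue. p \<in> \<Omega> \<longrightarrow> v p = piecewise Q p"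
  proof eventually_elim
    case (elim p)
    show ?case
    proof
      assume "p \<in> \<Omega>"
      then obtain T where T: "T \<in> \<T>" "p \<in> interior (body T)"
        using off_skeleton elim(2) by metis
      then show "v p = piecewise Q p"
        using elim(1) interior_subset piecewise_interior[OF T] by auto
    qed
  qed
  then show ?thesis
    using open_domain by (simp add: AE_restrict_space_iff)
qed

lemma weak_partial_cong_AE:
  assumes "v \<in> borel_measurable (lebesgue_on \<Omega>)" "w \<in> borel_measurable (lebesgue_on \<Omega>)"
    and eq: "AE p in lebesgue_on \<Omega>. v p = w p"
  shows "weak_partial_x \<Omega> w g \<Longrightarrow> weak_partial_x \<Omega> v g" "weak_partial_y \<Omega> w g \<Longrightarrow> weak_partial_y \<Omega> v g"
proof -
  have "(\<integral>p. v p * \<psi> p \<partial>lebesgue_on \<Omega>) = (\<integral>p. w p * \<psi> p \<partial>lebesgue_on \<Omega>)"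
    if "continuous_on UNIV \<psi>" for \<psi> :: "plane \<Rightarrow> real"
  proof (rule integral_cong_AE)
    have "\<psi> \<in> borel_measurable (lebesgue_on \<Omega>)"
      using borel_measurable_continuous_onI[OF that]
      by (intro measurable_restrict_space1 measurable_completion) simp
    then show "(\<lambda>p. v p * \<psi> p) \<in> borel_measurable (lebesgue_on \<Omega>)"
      "(\<lambda>p. w p * \<psi> p) \<in> borel_measurable (lebesgue_on \<Omega>)"
      using assms by auto
    show "AE p in lebesgue_on \<Omega>. v p * \<psi> p = w p * \<psi> p"
      using eq by eventually_elim simp
  qed
  note * = this[OF test_functionD(3)] this[OF test_functionD(4)]
  show "weak_partial_x \<Omega> w g \<Longrightarrow> weak_partial_x \<Omega> v g" "weak_partial_y \<Omega> w g \<Longrightarrow> weak_partial_y \<Omega> v g"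
    by (simp_all add: weak_partial_x_def weak_partial_y_def *)
qed

text \<open>Integration by parts is used three times, for \<open>q\<close> and for the two
  components of its gradient. Each of these has to match across edges; the second derivatives may
  jump, as only their square integrability is required.\<close>

lemma piecewise_polynomial_in_H2:
  assumes v: "v \<in> V_space \<Omega>" and "piecewise_polynomial \<T> v"
  shows "v \<in> H2 \<Omega>"
proof -
  have v2: "v \<in> L2 \<Omega>"
    using v by (simp add: V_space_def)
  obtain f where f: "f \<in> L2 \<Omega>" "weak_box \<Omega> v f"
    using v by (auto simp: V_space_def)
  \<comment> \<open>Triangles outside the mesh receive an arbitrary polynomial, such as a constant,
    so that \<open>q\<close> is total and later choices carry no side condition.\<close>
  have "\<forall>T. \<exists>q. real_polynomial_function q \<and> (T \<in> \<T> \<longrightarrow> (AE p in lebesgue_on (body T). v p = q p))"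
    using assms(2) real_polynomial_function.intros(2) unfolding piecewise_polynomial_def by metis
  then obtain q where q: "\<And>T. real_polynomial_function (q T)"
    and vq: "\<And>T. T \<in> \<T> \<Longrightarrow> AE p in lebesgue_on (body T). v p = q T p"
    by metis
  \<comment> \<open>The conclusion of the Taylor lemma as a predicate, so that partial derivatives
    are chosen for all triangles at once and then again for these derivatives.\<close>
  define P :: "(plane \<Rightarrow> real) \<Rightarrow> (plane \<Rightarrow> real) \<Rightarrow> (plane \<Rightarrow> real) \<Rightarrow> bool" where
    "P = (\<lambda>q qx qy. real_polynomial_function qx \<and> real_polynomial_function qy \<and>
      (\<forall>p. (q has_derivative (\<lambda>h. qx p * fst h + qy p * snd h)) (at p)) \<and>
      (\<forall>c. \<exists>R. continuous_on UNIV R \<and>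
        (\<forall>\<epsilon> h. q (c + \<epsilon> *\<^sub>R h) = q c + \<epsilon> * (qx c * fst h + qy c * snd h) + \<epsilon>\<^sup>2 * R (\<epsilon>, h))))"
  have ex: "\<exists>F G. \<forall>T. P (Q T) (F T) (G T)" if Q: "\<And>T. real_polynomial_function (Q T)"
    for Q :: "triangle \<Rightarrow> plane \<Rightarrow> real"
  proof -
    have "\<forall>T. \<exists>F G. P (Q T) F G"
      unfolding P_def by (intro allI real_polynomial_function_taylor Q)
    then show ?thesis
      by (simp only: choice_iff)
  qed
  obtain qx qy where P: "\<And>T. P (q T) (qx T) (qy T)"
    using ex[of q, OF q] by blast
  then have poly_q: "real_polynomial_function (qx T)" "real_polynomial_function (qy T)" for T
    by (simp_all add: P_def)
  obtain qxx qxy where Px: "\<And>T. P (qx T) (qxx T) (qxy T)"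
    using ex[of qx, OF poly_q(1)] by blast
  obtain qyx qyy where Py: "\<And>T. P (qy T) (qyx T) (qyy T)"
    using ex[of qy, OF poly_q(2)] by blast
  have der: "(q has_derivative (\<lambda>h. qx p * fst h + qy p * snd h)) (at p)" if "P q qx qy" for q qx qy p
    using that unfolding P_def by blast
  have cont: "continuous_on UNIV q" if "real_polynomial_function q" for q :: "plane \<Rightarrow> real"
    using that by (intro continuous_on_polymonial_function) (simp add: real_polynomial_function_eq)
  \<comment> \<open>The first-order Taylor coefficients at \<open>p\<close> are the values of
    \<open>qx\<close> and \<open>qy\<close> there, so one application of the jump conditions matches
    all three functions at the same split.\<close>
  have match: "\<exists>r n1 n2 T1 T2. local_split p r n1 n2 T1 T2 \<and> q T1 p = q T2 p \<and> qx T1 p = qx T2 p \<and> qy T1 p = qy T2 p"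
    if p: "p \<in> \<Omega> - nodes" for p
  proof -
    obtain r n1 n2 T1 T2 where s: "local_split p r n1 n2 T1 T2"
      using local_split_exists[of p] p by blast
    then have r: "0 < r" "ball p r \<subseteq> \<Omega>" "n1\<^sup>2 \<noteq> n2\<^sup>2" and T: "T1 \<in> \<T>" "T2 \<in> \<T>"
      and H: "{z \<in> ball p r. n1 * (fst z - fst p) + n2 * (snd z - snd p) > 0} \<subseteq> body T1"
        "{z \<in> ball p r. n1 * (fst z - fst p) + n2 * (snd z - snd p) < 0} \<subseteq> body T2"
      unfolding local_split_def by blast+
    have v1: "AE z in lebesgue. z \<in> ball p r \<longrightarrow> n1 * (fst z - fst p) + n2 * (snd z - snd p) > 0 \<longrightarrow> v z = q T1 z"
      using AE_lebesgue_on_body[OF T(1) vq[OF T(1)]] by eventually_elim (use H(1) in blast)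
    have v2: "AE z in lebesgue. z \<in> ball p r \<longrightarrow> n1 * (fst z - fst p) + n2 * (snd z - snd p) < 0 \<longrightarrow> v z = q T2 z"
      using AE_lebesgue_on_body[OF T(2) vq[OF T(2)]] by eventually_elim (use H(2) in blast)
    obtain R1 where R1: "continuous_on UNIV R1"
      "\<And>\<epsilon> h. q T1 (p + \<epsilon> *\<^sub>R h) = q T1 p + \<epsilon> * (qx T1 p * fst h + qy T1 p * snd h) + \<epsilon>\<^sup>2 * R1 (\<epsilon>, h)"
      using P[of T1] unfolding P_def by blast
    obtain R2 where R2: "continuous_on UNIV R2"
      "\<And>\<epsilon> h. q T2 (p + \<epsilon> *\<^sub>R h) = q T2 p + \<epsilon> * (qx T2 p * fst h + qy T2 p * snd h) + \<epsilon>\<^sup>2 * R2 (\<epsilon>, h)"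
      using P[of T2] unfolding P_def by blast
    have "q T1 p = q T2 p \<and> qx T1 p = qx T2 p \<and> qy T1 p = qy T2 p"
      by (rule jump_conditions[OF open_domain \<open>v \<in> L2 \<Omega>\<close> f r v1 v2 R1 R2 cont[OF q] cont[OF q]])
    with s show ?thesis
      by blast
  qed
  have weak: "weak_partial_x \<Omega> (piecewise Q) (piecewise F)" "weak_partial_y \<Omega> (piecewise Q) (piecewise G)"
    if P: "\<And>T. P (Q T) (F T) (G T)" and Q: "\<And>T. real_polynomial_function (Q T)"
      and eq: "\<And>p. p \<in> \<Omega> - nodes \<Longrightarrow> \<exists>r n1 n2 T1 T2. local_split p r n1 n2 T1 T2 \<and> Q T1 p = Q T2 p"
    for Q F G
  proof -
    have FG: "continuous_on UNIV (F T)" "continuous_on UNIV (G T)" for T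
      using P[of T] by (simp_all add: P_def cont)
    have "isCont (\<lambda>p. Q (cell p) p) p" if p: "p \<in> \<Omega> - nodes" for p
    proof -
      obtain r n1 n2 T1 T2 where "local_split p r n1 n2 T1 T2" "Q T1 p = Q T2 p"
        using eq[OF p] by blast
      then show ?thesis
        by (rule cell_continuous[where Q = Q]) (rule cont[OF Q])
    qed
    then show "weak_partial_x \<Omega> (piecewise Q) (piecewise F)" "weak_partial_y \<Omega> (piecewise Q) (piecewise G)"
      using weak_partials_piecewise[of Q F G, OF der[OF P] FG] by blast+
  qed
  have wq: "weak_partial_x \<Omega> (piecewise q) (piecewise qx)" "weak_partial_y \<Omega> (piecewise q) (piecewise qy)"
    by (rule weak[of q qx qy, OF P q]; use match in blast)+
  have wx: "weak_partial_x \<Omega> (piecewise qx) (piecewise qxx)" "weak_partial_y \<Omega> (piecewise qx) (piecewise qxy)"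
    by (rule weak[of qx qxx qxy, OF Px poly_q(1)]; use match in blast)+
  have wy: "weak_partial_x \<Omega> (piecewise qy) (piecewise qyx)" "weak_partial_y \<Omega> (piecewise qy) (piecewise qyy)"
    by (rule weak[of qy qyx qyy, OF Py poly_q(2)]; use match in blast)+
  have L2: "piecewise q \<in> L2 \<Omega>" "piecewise qx \<in> L2 \<Omega>" "piecewise qy \<in> L2 \<Omega>" "piecewise qxx \<in> L2 \<Omega>"
    "piecewise qxy \<in> L2 \<Omega>" "piecewise qyx \<in> L2 \<Omega>" "piecewise qyy \<in> L2 \<Omega>"
    using q poly_q Px Py unfolding P_def by (intro piecewise_in_L2 cont; blast)+
  have meas: "v \<in> borel_measurable (lebesgue_on \<Omega>)" "piecewise q \<in> borel_measurable (lebesgue_on \<Omega>)"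
    using v2 L2(1) by (simp_all add: L2_def)
  have "weak_partial_x \<Omega> v (piecewise qx)" "weak_partial_y \<Omega> v (piecewise qy)"
    using weak_partial_cong_AE[OF meas AE_eq_piecewise[OF vq]] wq by blast+
  moreover have "piecewise qx \<in> H1 \<Omega>" "piecewise qy \<in> H1 \<Omega>"
    using L2 wx wy unfolding One_nat_def sobolev.simps by blast+
  moreover have "H2 \<Omega> = {v \<in> L2 \<Omega>. \<exists>g1\<in>H1 \<Omega>. \<exists>g2\<in>H1 \<Omega>. weak_partial_x \<Omega> v g1 \<and> weak_partial_y \<Omega> v g2}"
    by (simp add: numeral_2_eq_2)
  ultimately show ?thesis
    using v2 by blast
qed

end

theorem corollary3p3:
  fixes \<Omega> :: "plane set" and \<T> :: "triangle set" and X :: "(plane \<Rightarrow> real) set" and h \<rho> :: real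
  assumes "open \<Omega>" and "connected \<Omega>" and "\<Omega> \<noteq> {}" and "bounded \<Omega>"
    and "piecewise_smooth_boundary \<Omega>"
    and "0 < h" and "h < 1"
    and "triangulation_of \<Omega> \<T>" and "mesh_size \<T> = h"
    and "0 < \<rho>" and "quasi_uniform \<rho> \<T>"
    and "linear_subspace_of X (V_space \<Omega>)"
    and "\<forall>v\<in>X. piecewise_polynomial \<T> v"
    and "\<forall>e\<in>interior_edges \<T>. \<not> type_I e"
  shows "X \<subseteq> H2 \<Omega>"
proof
  fix v assume "v \<in> X"
  then have "v \<in> V_space \<Omega>" "piecewise_polynomial \<T> v"
    using assms(12,13) by (auto simp: linear_subspace_of_def)
  moreover have "mesh \<Omega> \<T>"
    using assms by unfold_locales
  ultimately show "v \<in> H2 \<Omega>"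
    using mesh.piecewise_polynomial_in_H2 by blast
qed

end
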